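(* Let $(\Omega,\Sigma,\mu)$ be a measure space, $X(\mu)$ an ideal function space with the $\sigma$-property, $E$ a Banach space, $p\in(0,\infty)$, and $T\colon X(\mu)\to E$ a linear operator which is $p$-th power factorable with an order-w continuous extension. Then $[i]\colon X(\mu)\to L^p(m_T)\cap L^1(m_T)$ is well defined, $T=I_{m_T}\circ[i]$, and $I_{m_T}\colon L^p(m_T)\cap L^1(m_T)\to E$ is $p$-th power factorable with an order-w continuous extension. Moreover the factorization is optimal: if $\xi$ is a measure on $\Sigma$ with $\xi\ll\mu$, $Z(\xi)$ is an ideal function space such that $[i]\colon X(\mu)\to Z(\xi)$ is well defined, and $S\colon Z(\xi)\to E$ is a linear operator with $T=S\circ[i]$ which is $p$-th power factorable with an order-w continuous extension, then $[i]\colon Z(\xi)\to L^p(m_T)\cap L^1(m_T)$ is well defined and $S=I_{m_T}\circ[i]$.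
   Context: $L^0(\lambda)$: $\lambda$-a.e. classes of $\Sigma$-measurable real functions. Ideal function space (i.f.s.) $Y(\lambda)\subset L^0(\lambda)$: vector subspace with $f\in Y(\lambda)$, $g\in L^0(\lambda)$, $|g|\le|f|$ a.e. $\Rightarrow g\in Y(\lambda)$. $\sigma$-property: $\Omega=\bigcup_n\Omega_n$, $\Omega_n\in\Sigma$, $\chi_{\Omega_n}\in X(\mu)$. For $q\in(0,\infty)$, $Y(\lambda)^q=\{f\in L^0(\lambda):|f|^q\in Y(\lambda)\}$; $Y(\lambda)+W(\lambda)=\{f=f_1+f_2\text{ a.e.}: f_1\in Y(\lambda),f_2\in W(\lambda)\}$. A linear operator $R$ on an i.f.s. is order-w continuous if $R(f_n)\to R(f)$ weakly whenever $0\le f_n\uparrow f$ a.e. within the space; $R\colon Y(\lambda)\to E$ is $p$-th power factorable with an order-w continuous extension if there is an order-w continuous linear $\tilde R\colon Y(\lambda)^{1/p}+Y(\lambda)\to E$ with $\tilde R=R$ on $Y(\lambda)$. For $\xi\ll\lambda$ (i.e. $\lambda(A)=0\Rightarrow\xi(A)=0$), $[i]$ maps the $\lambda$-class of $f$ to its $\xi$-class; "$[i]\colon Y(\lambda)\to W(\xi)$ is well defined" means $\xi\ll\lambda$ and the $\xi$-class of each $f\in Y(\lambda)$ lies in $W(\xi)$. $\Sigma_{X(\mu)}=\{A\in\Sigma:\chi_A\in X(\mu)\}$ ($\delta$-ring with local $\sigma$-algebra $\Sigma$), $m_T(A)=T(\chi_A)$ on $\Sigma_{X(\mu)}$ (a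 vector measure under the hypothesis). For a vector measure $m$ on $\Sigma_{X(\mu)}$: $|x^*m|$ the variation of $x^*\circ m$ on $\Sigma$, $\|m\|=\sup_{x^*\in B_{E^*}}|x^*m|$, $L^0(m)$ = $\Sigma$-measurable functions modulo $\|m\|$-null sets; $L^1(m)$ = those $f\in L^0(m)$ with $f\in L^1(|x^*m|)$ for all $x^*$ and, for each $A\in\Sigma$, some $\int_Af\,dm\in E$ with $x^*(\int_Af\,dm)=\int_Af\,dx^*m$ for all $x^*$; $I_m(f)=\int_\Omega f\,dm$; $L^p(m)=\{f\in L^0(m):|f|^p\in L^1(m)\}$. $L^p(m_T)\cap L^1(m_T)$ is regarded as an i.f.s. over a measure on $\Sigma$ having the same null sets as $\|m_T\|$. *)

theory Defs
  imports "HOL-Analysis.Analysis"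
begin

text \<open>An ideal function space over a measure on the measurable space of M is
represented by the set of all (Sigma-measurable) representatives of its classes.
It only depends on the family Nl of null sets of the underlying measure.
A property holds a.e. w.r.t. a null-set family Nl if its failure set (inside the
space) is contained in a member of Nl.\<close>

definition aew :: "'a measure \<Rightarrow> 'a set set \<Rightarrow> ('a \<Rightarrow> bool) \<Rightarrow> bool" where
  "aew M Nl P \<longleftrightarrow> (\<exists>N\<in>Nl. {x \<in> space M. \<not> P x} \<subseteq> N)"

definition ifs :: "'a measure \<Rightarrow> 'a set set \<Rightarrow> ('a \<Rightarrow> real) set \<Rightarrow> bool" where
  "ifs M Nl Y \<longleftrightarrow>
     Y \<subseteq> borel_measurable M \<and> (\<lambda>x. 0) \<in> Y \<and>
     (\<forall>f\<in>Y. \<forall>g\<in>Y. (\<lambda>x. f x + g x) \<in> Y) \<and>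
     (\<forall>c. \<forall>f\<in>Y. (\<lambda>x. c * f x) \<in> Y) \<and>
     (\<forall>f\<in>Y. \<forall>g\<in>borel_measurable M. aew M Nl (\<lambda>x. \<bar>g x\<bar> \<le> \<bar>f x\<bar>) \<longrightarrow> g \<in> Y)"

definition ifs_pow :: "'a measure \<Rightarrow> ('a \<Rightarrow> real) set \<Rightarrow> real \<Rightarrow> ('a \<Rightarrow> real) set" where
  "ifs_pow M Y q = {f \<in> borel_measurable M. (\<lambda>x. \<bar>f x\<bar> powr q) \<in> Y}"

definition ifs_sum :: "'a measure \<Rightarrow> 'a set set \<Rightarrow> ('a \<Rightarrow> real) set \<Rightarrow> ('a \<Rightarrow> real) set
    \<Rightarrow> ('a \<Rightarrow> real) set" where
  "ifs_sum M Nl Y W = {f \<in> borel_measurable M. \<exists>f1\<in>Y. \<exists>f2\<in>W. aew M Nl (\<lambda>x. f x = f1 x + f2 x)}"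

definition lin_op :: "'a measure \<Rightarrow> 'a set set \<Rightarrow> ('a \<Rightarrow> real) set \<Rightarrow> (('a \<Rightarrow> real) \<Rightarrow> 'e::real_normed_vector) \<Rightarrow> bool" where
  "lin_op M Nl Y R \<longleftrightarrow>
     (\<forall>f\<in>Y. \<forall>g\<in>Y. aew M Nl (\<lambda>x. f x = g x) \<longrightarrow> R f = R g) \<and>
     (\<forall>f\<in>Y. \<forall>g\<in>Y. R (\<lambda>x. f x + g x) = R f + R g) \<and>
     (\<forall>c. \<forall>f\<in>Y. R (\<lambda>x. c * f x) = c *\<^sub>R R f)"

definition weak_conv :: "(nat \<Rightarrow> 'e::real_normed_vector) \<Rightarrow> 'e \<Rightarrow> bool" where
  "weak_conv xs x \<longleftrightarrow> (\<forall>\<phi>::'e \<Rightarrow> real. bounded_linear \<phi> \<longrightarrow> (\<lambda>n. \<phi> (xs n)) \<longlonglongrightarrow> \<phi> x)"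

definition order_w_cont :: "'a measure \<Rightarrow> 'a set set \<Rightarrow> ('a \<Rightarrow> real) set \<Rightarrow> (('a \<Rightarrow> real) \<Rightarrow> 'e::real_normed_vector) \<Rightarrow> bool" where
  "order_w_cont M Nl Y R \<longleftrightarrow>
     (\<forall>fs f. (\<forall>n. fs n \<in> Y) \<longrightarrow> f \<in> Y \<longrightarrow>
        aew M Nl (\<lambda>x. (\<forall>n. 0 \<le> fs n x \<and> fs n x \<le> fs (Suc n) x) \<and> (\<lambda>n. fs n x) \<longlonglongrightarrow> f x) \<longrightarrow>
        weak_conv (\<lambda>n. R (fs n)) (R f))"

definition pth_power_factorable :: "'a measure \<Rightarrow> 'a set set \<Rightarrow> ('a \<Rightarrow> real) set \<Rightarrow> (('a \<Rightarrow> real) \<Rightarrow> 'e::real_normed_vector) \<Rightarrow> real \<Rightarrow> bool" where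
  "pth_power_factorable M Nl Y R p \<longleftrightarrow>
     (\<exists>R'. lin_op M Nl (ifs_sum M Nl (ifs_pow M Y (1 / p)) Y) R' \<and>
           order_w_cont M Nl (ifs_sum M Nl (ifs_pow M Y (1 / p)) Y) R' \<and>
           (\<forall>f\<in>Y. R' f = R f))"

definition sigma_property :: "'a measure \<Rightarrow> ('a \<Rightarrow> real) set \<Rightarrow> bool" where
  "sigma_property M X \<longleftrightarrow>
     (\<exists>\<Omega>n::nat \<Rightarrow> 'a set. (\<forall>n. \<Omega>n n \<in> sets M \<and> indicator (\<Omega>n n) \<in> X) \<and> (\<Union>n. \<Omega>n n) = space M)"

definition Sigma_X :: "'a measure \<Rightarrow> ('a \<Rightarrow> real) set \<Rightarrow> 'a set set" where
  "Sigma_X M X = {A \<in> sets M. (indicator A :: 'a \<Rightarrow> real) \<in> X}"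

definition m_T :: "(('a \<Rightarrow> real) \<Rightarrow> 'e) \<Rightarrow> 'a set \<Rightarrow> 'e" where
  "m_T T A = T (indicator A)"

definition totvar :: "'a set set \<Rightarrow> ('a set \<Rightarrow> real) \<Rightarrow> 'a set \<Rightarrow> ennreal" where
  "totvar R \<nu> A = (SUP P \<in> {P. finite P \<and> P \<subseteq> R \<and> disjoint P \<and> (\<forall>B\<in>P. B \<subseteq> A)}.
                      ennreal (\<Sum>B\<in>P. \<bar>\<nu> B\<bar>))"

definition posvar :: "'a set set \<Rightarrow> ('a set \<Rightarrow> real) \<Rightarrow> 'a set \<Rightarrow> ennreal" where
  "posvar R \<nu> A = (SUP B \<in> {B \<in> R. B \<subseteq> A}. ennreal (\<nu> B))"

definition negvar :: "'a set set \<Rightarrow> ('a set \<Rightarrow> real) \<Rightarrow> 'a set \<Rightarrow> ennreal" where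
  "negvar R \<nu> A = (SUP B \<in> {B \<in> R. B \<subseteq> A}. ennreal (- \<nu> B))"

definition var_measure :: "'a measure \<Rightarrow> 'a set set \<Rightarrow> ('a set \<Rightarrow> real) \<Rightarrow> 'a measure" where
  "var_measure M R \<nu> = measure_of (space M) (sets M) (totvar R \<nu>)"

definition scal_int :: "'a measure \<Rightarrow> 'a set set \<Rightarrow> ('a set \<Rightarrow> real) \<Rightarrow> 'a set \<Rightarrow> ('a \<Rightarrow> real) \<Rightarrow> real" where
  "scal_int M R \<nu> A f =
     (\<integral>x. indicator A x * f x \<partial>(measure_of (space M) (sets M) (posvar R \<nu>))) -
     (\<integral>x. indicator A x * f x \<partial>(measure_of (space M) (sets M) (negvar R \<nu>)))"

text \<open>The null sets of the semivariation ||m||.\<close>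
definition vm_nulls :: "'a measure \<Rightarrow> 'a set set \<Rightarrow> ('a set \<Rightarrow> 'e::real_normed_vector) \<Rightarrow> 'a set set" where
  "vm_nulls M R m = {A \<in> sets M. \<forall>\<phi>::'e \<Rightarrow> real. bounded_linear \<phi> \<longrightarrow> totvar R (\<lambda>B. \<phi> (m B)) A = 0}"

definition L1_vm :: "'a measure \<Rightarrow> 'a set set \<Rightarrow> ('a set \<Rightarrow> 'e::real_normed_vector) \<Rightarrow> ('a \<Rightarrow> real) set" where
  "L1_vm M R m = {f \<in> borel_measurable M.
      (\<forall>\<phi>::'e \<Rightarrow> real. bounded_linear \<phi> \<longrightarrow> integrable (var_measure M R (\<lambda>B. \<phi> (m B))) f) \<and>
      (\<forall>A\<in>sets M. \<exists>v. \<forall>\<phi>::'e \<Rightarrow> real. bounded_linear \<phi> \<longrightarrow> \<phi> v = scal_int M R (\<lambda>B. \<phi> (m B)) A f)}"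

definition Lp_vm :: "'a measure \<Rightarrow> 'a set set \<Rightarrow> ('a set \<Rightarrow> 'e::real_normed_vector) \<Rightarrow> real \<Rightarrow> ('a \<Rightarrow> real) set" where
  "Lp_vm M R m p = {f \<in> borel_measurable M. (\<lambda>x. \<bar>f x\<bar> powr p) \<in> L1_vm M R m}"

definition I_vm :: "'a measure \<Rightarrow> 'a set set \<Rightarrow> ('a set \<Rightarrow> 'e::real_normed_vector) \<Rightarrow> ('a \<Rightarrow> real) \<Rightarrow> 'e" where
  "I_vm M R m f = (SOME v. \<forall>\<phi>::'e \<Rightarrow> real. bounded_linear \<phi> \<longrightarrow> \<phi> v = scal_int M R (\<lambda>B. \<phi> (m B)) (space M) f)"

end

theory Submission
  imports Defs
begin

text \<open>For a functional \<open>\<phi>\<close> put \<open>\<nu> A = \<phi> (m A)\<close>, where \<open>m A = T \<chi>\<^sub>A\<close>; order-w continuity makes \<open>\<nu>\<close> countably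
additive on the delta-ring. Let P be a Hahn set of \<open>\<nu>\<close>. The positive variation of \<open>\<nu>\<close> is
\<open>A \<mapsto> \<phi> (T \<chi>\<^bsub>A \<inter> P\<^esub>)\<close>, and approximating f from below by simple functions over the delta-ring shows
that its integral is \<open>f \<mapsto> \<phi> (T (\<chi>\<^sub>P f))\<close>; similarly for the negative variation. Hence f is
integrable with respect to m with integral \<open>T f\<close>. Optimality is the same argument for the extension
of S to \<open>Z\<^bsup>1/p\<^esup> + Z\<close>, which contains \<open>|f|\<^bsup>p\<^esup>\<close> for every f in Z; the case \<open>Z = X\<close>, \<open>S = T\<close> gives
the factorization of T itself. Finally the extension of the integration operator is again
integration, by dominated convergence for the scalar variations.\<close>

section \<open>Separation of points by bounded functionals\<close>

text \<open>Three obstacles shape the proof. The integral \<open>I_vm\<close> is known only through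
  its values under functionals, so identifying it with \<open>T f\<close> requires that functionals
  separate points; a Hahn-Banach argument provides this. Each scalar measure lives only on the
  delta-ring and may have infinite variation on the whole space, so its variations are built as
  suprema over the delta-ring and its Hahn set is glued from local ones. Finally, the vector measure
  is always the one of X on \<open>Sigma_X M X\<close>, whereas the extension of S acts on a larger
  space over \<xi>, which may have more null sets than M. The representation of functionals is
  therefore proved for a space Y and a delta-ring R that merely has its indicators in Y. The
  sigma-property of X keeps R rich enough to approximate all of Y, and the result moves from \<xi>
  to M because integrals and null sets of a vector measure depend only on the sigma-algebra and on
  the values on R.\<close>

definition sublinear :: "('a::real_vector \<Rightarrow> real) \<Rightarrow> bool" where
  "sublinear q \<longleftrightarrow> (\<forall>x y. q (x + y) \<le> q x + q y) \<and> (\<forall>c\<ge>0. \<forall>x. q (c *\<^sub>R x) \<le> c * q x)"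

lemma sublinear_add: "sublinear q \<Longrightarrow> q (x + y) \<le> q x + q y"
  and sublinear_scaleR_le: "sublinear q \<Longrightarrow> 0 \<le> c \<Longrightarrow> q (c *\<^sub>R x) \<le> c * q x"
  by (auto simp: sublinear_def)

lemma sublinear_zero: "sublinear q \<Longrightarrow> q 0 = 0"
  using sublinear_add[of q 0 0] sublinear_scaleR_le[of q 0 0] by auto

text \<open>Applying the assumed inequality to the factor \<open>1/c\<close> and the vector
  \<open>c *\<^sub>R x\<close> reverses it. So the definition can ask for an inequality only, the
  form that infima inherit.\<close>

lemma sublinear_scaleR:
  assumes "sublinear q" "0 \<le> c" shows "q (c *\<^sub>R x) = c * q x"
proof (cases "c = 0")
  case False
  then have "c > 0" using assms by auto
  have "q ((1/c) *\<^sub>R (c *\<^sub>R x)) \<le> (1/c) * q (c *\<^sub>R x)"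
    using assms by (intro sublinear_scaleR_le) auto
  then have "c * q x \<le> q (c *\<^sub>R x)" using \<open>c > 0\<close> by (simp add: field_simps)
  with sublinear_scaleR_le[OF assms, of x] show ?thesis by simp
qed (use assms sublinear_zero in auto)

lemma sublinear_minus: "sublinear q \<Longrightarrow> - q (- x) \<le> q x"
  using sublinear_add[of q x "- x"] sublinear_zero[of q] by simp

text \<open>A directedness condition in place of a pointwise one: k may depend on i, j, x and y. It
  serves both the infimum over a ray, with \<open>k = i + j\<close>, and the infimum over a chain,
  with k the smaller of the two functionals.\<close>

lemma sublinear_INF:
  assumes I: "I \<noteq> {}" and bdd: "\<And>x. bdd_below ((\<lambda>i. f i x) ` I)"
    and add: "\<And>i j x y. i \<in> I \<Longrightarrow> j \<in> I \<Longrightarrow> \<exists>k\<in>I. f k (x + y) \<le> f i x + f j y"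
    and scale: "\<And>i c x. i \<in> I \<Longrightarrow> 0 \<le> c \<Longrightarrow> \<exists>k\<in>I. f k (c *\<^sub>R x) \<le> c * f i x"
  shows "sublinear (\<lambda>x::'a::real_vector. INF i\<in>I. f i x :: real)"
  unfolding sublinear_def
proof (intro conjI allI impI)
  fix x y
  have le: "(INF i\<in>I. f i (x + y)) \<le> f i x + f j y" if "i \<in> I" "j \<in> I" for i j
    using add[OF that, of x y] cINF_lower[OF bdd, of _ "x + y"] by force
  have "(INF i\<in>I. f i (x + y)) - f i x \<le> (INF j\<in>I. f j y)" if "i \<in> I" for i
    using le[OF that] I by (intro cINF_greatest) (auto simp: algebra_simps)
  then have "(INF i\<in>I. f i (x + y)) - (INF j\<in>I. f j y) \<le> (INF i\<in>I. f i x)"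
    using I by (intro cINF_greatest) (auto simp: algebra_simps)
  then show "(INF i\<in>I. f i (x + y)) \<le> (INF i\<in>I. f i x) + (INF i\<in>I. f i y)" by simp
next
  fix c :: real and x assume c: "0 \<le> c"
  have le: "(INF i\<in>I. f i (c *\<^sub>R x)) \<le> c * f i x" if "i \<in> I" for i
    using scale[OF that c, of x] cINF_lower[OF bdd, of _ "c *\<^sub>R x"] by force
  show "(INF i\<in>I. f i (c *\<^sub>R x)) \<le> c * (INF i\<in>I. f i x)"
  proof (cases "c = 0")
    case False
    then have "(INF i\<in>I. f i (c *\<^sub>R x)) / c \<le> (INF i\<in>I. f i x)"
      using c I le by (intro cINF_greatest) (auto simp: field_simps)
    then show ?thesis using c False by (simp add: field_simps)
  qed (use le I in auto)
qed

text \<open>\<open>q'\<close> is the largest sublinear functional below q whose value at -y is at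
  most -q y. Tilting a minimal functional yields oddness; tilting the norm yields a functional that
  does not vanish at y.\<close>

lemma sublinear_tilt:
  fixes q :: "'a::real_vector \<Rightarrow> real" and y
  assumes q: "sublinear q"
  defines "q' \<equiv> (\<lambda>x. INF t\<in>{0..}. q (x + t *\<^sub>R y) - t * q y)"
  shows "sublinear q'" "q' x \<le> q x" "q' (- y) \<le> - q y"
proof -
  have bdd: "bdd_below ((\<lambda>t. q (x + t *\<^sub>R y) - t * q y) ` {0..})" for x
  proof (rule bdd_belowI2)
    fix t :: real assume "t \<in> {0..}"
    then show "- q (- x) \<le> q (x + t *\<^sub>R y) - t * q y"
      using sublinear_add[OF q, of "x + t *\<^sub>R y" "- x"] sublinear_scaleR[OF q, of t y] by simp
  qed
  show "sublinear q'" unfolding q'_def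
  proof (rule sublinear_INF)
    fix i j :: real and x z assume "i \<in> {0..}" "j \<in> {0..}"
    then show "\<exists>k\<in>{0..}. q (x + z + k *\<^sub>R y) - k * q y \<le> q (x + i *\<^sub>R y) - i * q y + (q (z + j *\<^sub>R y) - j * q y)"
      using sublinear_add[OF q, of "x + i *\<^sub>R y" "z + j *\<^sub>R y"]
      by (intro bexI[of _ "i + j"]) (auto simp: algebra_simps)
  next
    fix i c :: real and x assume "i \<in> {0..}" "0 \<le> c"
    then show "\<exists>k\<in>{0..}. q (c *\<^sub>R x + k *\<^sub>R y) - k * q y \<le> c * (q (x + i *\<^sub>R y) - i * q y)"
      using sublinear_scaleR[OF q, of c "x + i *\<^sub>R y"]
      by (intro bexI[of _ "c * i"]) (auto simp: algebra_simps)
  qed (use bdd in auto)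
  show "q' x \<le> q x" unfolding q'_def using cINF_lower[OF bdd, of 0 x] by simp
  show "q' (- y) \<le> - q y"
    unfolding q'_def using cINF_lower[OF bdd, of 1 "- y"] sublinear_zero[OF q] by simp
qed

text \<open>A minimal sublinear functional is unchanged by every tilt, hence odd, hence linear.\<close>

lemma ex_linear_below_sublinear:
  fixes p :: "'a::real_vector \<Rightarrow> real"
  assumes p: "sublinear p"
  obtains \<phi> where "linear \<phi>" "\<And>x. \<phi> x \<le> p x"
proof -
  let ?A = "{q. sublinear q \<and> q \<le> p}"
  \<comment> \<open>The order is reversed, so the maximal element given by Zorn's lemma is a
    pointwise minimal sublinear functional.\<close>
  let ?P = "\<lambda>q q'::'a \<Rightarrow> real. q' \<le> q"
  have "\<exists>m\<in>?A. \<forall>a\<in>?A. ?P m a \<longrightarrow> a = m"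
  proof (rule predicate_Zorn)
    show "partial_order_on ?A (relation_of ?P ?A)"
      by (rule partial_order_on_relation_ofI) auto
    fix C assume C: "C \<in> Chains (relation_of ?P ?A)"
    then have sub: "q \<in> C \<Longrightarrow> sublinear q \<and> q \<le> p" for q
      by (auto simp: Chains_def relation_of_def)
    have total: "q \<in> C \<Longrightarrow> q' \<in> C \<Longrightarrow> q \<le> q' \<or> q' \<le> q" for q q'
      using C by (auto simp: Chains_def relation_of_def)
    show "\<exists>u\<in>?A. \<forall>a\<in>C. ?P a u"
    proof (cases "C = {}")
      case False
      let ?u = "\<lambda>x. INF q\<in>C. q x"
      \<comment> \<open>Every sublinear q below p satisfies -p(-x) \<le> -q(-x) \<le> q x, a bound
        that is uniform over the chain and keeps the infimum finite.\<close>
      have bdd: "bdd_below ((\<lambda>q. q x) ` C)" for x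
      proof (rule bdd_belowI2)
        fix q assume "q \<in> C"
        then show "- p (- x) \<le> q x"
          using sub[of q] sublinear_minus[of q x] by (force simp: le_fun_def intro: order_trans[rotated])
      qed
      have "sublinear ?u"
      proof (rule sublinear_INF)
        fix i j x y assume ij: "i \<in> C" "j \<in> C"
        show "\<exists>k\<in>C. k (x + y) \<le> i x + j y"
          using total[OF ij]
        proof
          assume "i \<le> j" then show ?thesis
            using ij sub[of i] sublinear_add[of i x y] le_funD[of i j y] by (intro bexI[of _ i]) auto
        next
          assume "j \<le> i" then show ?thesis
            using ij sub[of j] sublinear_add[of j x y] le_funD[of j i x] by (intro bexI[of _ j]) auto
        qed
      next
        fix i c x assume "i \<in> C" "(0::real) \<le> c"
        then show "\<exists>k\<in>C. k (c *\<^sub>R x) \<le> c * i x"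
          using sub[of i] sublinear_scaleR_le[of i c x] by (intro bexI[of _ i]) auto
      qed (use bdd False in auto)
      moreover have "?u \<le> q" if "q \<in> C" for q
        using that by (intro le_funI cINF_lower[OF bdd])
      ultimately show ?thesis
        using False sub by (intro bexI[of _ ?u]) (auto intro: order_trans)
    qed (use p in auto)
  qed
  then obtain q where q: "sublinear q" "q \<le> p"
    and min: "\<And>r. sublinear r \<Longrightarrow> r \<le> q \<Longrightarrow> r = q"
    by (blast intro: order_trans)
  have neg: "q (- y) = - q y" for y
  proof -
    have tilt: "(\<lambda>x. INF t\<in>{0..}. q (x + t *\<^sub>R y) - t * q y) = q"
      by (rule min[OF sublinear_tilt(1)[OF q(1)] le_funI[OF sublinear_tilt(2)[OF q(1)]]])
    have "q (- y) \<le> - q y" using sublinear_tilt(3)[OF q(1), of y] fun_cong[OF tilt, of "- y"] by linarith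
    then show ?thesis using sublinear_minus[OF q(1), of y] by simp
  qed
  have "linear q"
  proof (rule linearI)
    fix x y
    show "q (x + y) = q x + q y"
      using sublinear_add[OF q(1), of x y] sublinear_add[OF q(1), of "- x" "- y"] neg[of "x + y"] neg[of x] neg[of y]
      by simp
  next
    fix c :: real and x
    show "q (c *\<^sub>R x) = c *\<^sub>R q x"
    proof (cases "0 \<le> c")
      case False
      then show ?thesis using neg[of "c *\<^sub>R x"] sublinear_scaleR[OF q(1), of "- c" x] by simp
    qed (use sublinear_scaleR[OF q(1)] in auto)
  qed
  then show ?thesis using q(2) that by (auto simp: le_fun_def)
qed

text \<open>A linear functional below the norm tilted by \<open>y = v - w\<close> is bounded and has
  \<phi> (-y) \<le> - norm y, so \<phi> y = 0 forces y = 0. This makes the value chosen in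
  \<open>I_vm\<close> unique.\<close>

lemma bounded_linear_functionals_separate:
  fixes v w :: "'e::real_normed_vector"
  assumes eq: "\<And>\<phi>::'e \<Rightarrow> real. bounded_linear \<phi> \<Longrightarrow> \<phi> v = \<phi> w"
  shows "v = w"
proof -
  define y where "y = v - w"
  have n: "sublinear (norm :: 'e \<Rightarrow> real)"
    by (auto simp: sublinear_def norm_triangle_ineq)
  note t = sublinear_tilt[OF n, where y = y]
  obtain \<phi> :: "'e \<Rightarrow> real" where \<phi>: "linear \<phi>"
    and le: "\<And>x. \<phi> x \<le> (INF t\<in>{0..}. norm (x + t *\<^sub>R y) - t * norm y)"
    by (rule ex_linear_below_sublinear[OF t(1)]) auto
  have le_norm: "\<phi> x \<le> norm x" for x using le[of x] t(2)[of x] by linarith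
  have "\<bar>\<phi> x\<bar> \<le> norm x" for x
    using le_norm[of x] le_norm[of "- x"] linear_neg[OF \<phi>, of x] by auto
  then have "bounded_linear \<phi>"
    using \<phi> by (intro bounded_linear_intro[where K = 1]) (auto simp: linear_add linear_cmul)
  then have "\<phi> y = 0" using eq linear_diff[OF \<phi>] by (simp add: y_def)
  moreover have "\<phi> (- y) \<le> - norm y" using le[of "- y"] t(3) by linarith
  ultimately show ?thesis using linear_neg[OF \<phi>, of y] by (simp add: y_def)
qed

section \<open>Signed measures on a delta-ring\<close>

text \<open>Countable additivity is demanded only when the union stays in R, so \<nu> need not
  extend to a signed measure on the sigma-algebra. Every application must therefore first confine
  the union to a member of R.\<close>

locale delta_ring_measure =
  fixes M :: "'a measure" and R :: "'a set set" and \<nu> :: "'a set \<Rightarrow> real"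
  assumes R_sets: "A \<in> R \<Longrightarrow> A \<in> sets M"
    and R_subset: "A \<in> R \<Longrightarrow> B \<in> sets M \<Longrightarrow> B \<subseteq> A \<Longrightarrow> B \<in> R"
    and R_Un: "A \<in> R \<Longrightarrow> B \<in> R \<Longrightarrow> A \<union> B \<in> R"
    and R_cover: "\<exists>\<Omega>::nat \<Rightarrow> 'a set. range \<Omega> \<subseteq> R \<and> (\<Union>n. \<Omega> n) = space M"
    and countably_add: "\<And>A::nat \<Rightarrow> 'a set. range A \<subseteq> R \<Longrightarrow> disjoint_family A \<Longrightarrow> (\<Union>n. A n) \<in> R \<Longrightarrow>
      (\<lambda>n. \<nu> (A n)) sums \<nu> (\<Union>n. A n)"
begin

lemma R_empty: "{} \<in> R"
  using R_cover R_subset[of _ "{}"] by blast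

lemma R_Int: "A \<in> R \<Longrightarrow> B \<in> sets M \<Longrightarrow> A \<inter> B \<in> R"
  and R_Diff: "A \<in> R \<Longrightarrow> B \<in> sets M \<Longrightarrow> A - B \<in> R"
  using R_subset[of A "A \<inter> B"] R_subset[of A "A - B"] R_sets by auto

lemma R_finite_Union: "finite P \<Longrightarrow> P \<subseteq> R \<Longrightarrow> \<Union>P \<in> R"
  by (induction rule: finite_induct) (auto simp: R_empty R_Un)

lemma empty: "\<nu> {} = 0"
proof -
  have "(\<lambda>n::nat. \<nu> {}) sums \<nu> (\<Union>n::nat. {})"
    by (rule countably_add) (auto simp: disjoint_family_on_def R_empty)
  then have "(\<lambda>n::nat. \<nu> {}) \<longlonglongrightarrow> 0" by (intro summable_LIMSEQ_zero sums_summable)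
  then show ?thesis by (simp add: LIMSEQ_const_iff)
qed

lemma add: "A \<in> R \<Longrightarrow> B \<in> R \<Longrightarrow> A \<inter> B = {} \<Longrightarrow> \<nu> (A \<union> B) = \<nu> A + \<nu> B"
proof -
  assume AB: "A \<in> R" "B \<in> R" "A \<inter> B = {}"
  have "(\<lambda>n. \<nu> (binaryset A B n)) sums \<nu> (\<Union>n. binaryset A B n)"
    using AB by (intro countably_add)
      (auto simp: disjoint_family_on_def UN_binaryset_eq R_Un R_empty binaryset_def split: if_splits)
  then show ?thesis
    using binaryset_sums[of \<nu> A B] empty sums_unique2 by (fastforce simp: UN_binaryset_eq)
qed

lemma split: "A \<in> R \<Longrightarrow> B \<in> sets M \<Longrightarrow> \<nu> A = \<nu> (A \<inter> B) + \<nu> (A - B)"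
  using add[OF R_Int[of A B] R_Diff[of A B]] by (metis Diff_disjoint Int_Diff_Un inf_assoc inf_bot_right)

lemma diff: "A \<in> R \<Longrightarrow> B \<in> sets M \<Longrightarrow> B \<subseteq> A \<Longrightarrow> \<nu> (A - B) = \<nu> A - \<nu> B"
  using split[of A B] by (simp add: Int_absorb1)

lemma finite_add: "finite P \<Longrightarrow> P \<subseteq> R \<Longrightarrow> disjoint P \<Longrightarrow> \<nu> (\<Union>P) = (\<Sum>B\<in>P. \<nu> B)"
proof (induction rule: finite_induct)
  case (insert B P)
  have "B \<inter> \<Union>P = {}"
    using insert.hyps insert.prems by (fastforce simp: disjoint_def)
  moreover have "disjoint P" using insert.prems by (auto simp: disjoint_def)
  ultimately show ?case using insert R_finite_Union[of P] by (simp add: add)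
qed (simp add: empty)

lemma uminus: "delta_ring_measure M R (\<lambda>A. - \<nu> A)"
proof
  show "\<exists>\<Omega>::nat \<Rightarrow> 'a set. range \<Omega> \<subseteq> R \<and> (\<Union>n. \<Omega> n) = space M" by (rule R_cover)
  fix A :: "nat \<Rightarrow> 'a set"
  assume "range A \<subseteq> R" "disjoint_family A" "(\<Union>n. A n) \<in> R"
  then show "(\<lambda>n. - \<nu> (A n)) sums - \<nu> (\<Union>n. A n)"
    by (intro sums_minus countably_add)
qed (fact R_sets R_subset R_Un)+

section \<open>Positive and negative variation: countable additivity and finiteness on the
  delta-ring\<close>

lemma posvar_upper: "B \<in> R \<Longrightarrow> B \<subseteq> A \<Longrightarrow> ennreal (\<nu> B) \<le> posvar R \<nu> A"
  unfolding posvar_def by (rule SUP_upper) auto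

lemma posvar_least:
  "(\<And>B. B \<in> R \<Longrightarrow> B \<subseteq> A \<Longrightarrow> ennreal (\<nu> B) \<le> c) \<Longrightarrow> posvar R \<nu> A \<le> c"
  unfolding posvar_def by (rule SUP_least) auto

lemma posvar_superadd:
  assumes "A \<inter> B = {}"
  shows "posvar R \<nu> A + posvar R \<nu> B \<le> posvar R \<nu> (A \<union> B)"
proof -
  have *: "ennreal (\<nu> C) + ennreal (\<nu> D) \<le> posvar R \<nu> (A \<union> B)"
    if "C \<in> R" "C \<subseteq> A" "D \<in> R" "D \<subseteq> B" for C D
  proof -
    \<comment> \<open>\<open>ennreal\<close> truncates negative values to 0, so additivity of \<nu>
      helps only if both values are nonnegative; otherwise one of the two sets alone dominates the
      sum.\<close>
    consider "\<nu> C \<ge> 0" "\<nu> D \<ge> 0" | "\<nu> C < 0" | "\<nu> D < 0" by linarith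
    then show ?thesis
    proof cases
      case 1
      have "\<nu> C + \<nu> D = \<nu> (C \<union> D)" using that assms by (subst add) auto
      then have "ennreal (\<nu> C) + ennreal (\<nu> D) = ennreal (\<nu> (C \<union> D))"
        using 1 by (simp flip: ennreal_plus)
      then show ?thesis using that by (simp add: posvar_upper R_Un subset_trans le_supI1 le_supI2)
    next
      case 2 then show ?thesis using posvar_upper[of D "A \<union> B"] that by (auto simp: ennreal_neg)
    next
      case 3 then show ?thesis using posvar_upper[of C "A \<union> B"] that by (auto simp: ennreal_neg)
    qed
  qed
  have ne: "{B \<in> R. B \<subseteq> A} \<noteq> {}" for A using R_empty by auto
  have "posvar R \<nu> A + posvar R \<nu> B =
     (SUP C\<in>{C \<in> R. C \<subseteq> A}. SUP D\<in>{D \<in> R. D \<subseteq> B}. ennreal (\<nu> C) + ennreal (\<nu> D))"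
    unfolding posvar_def by (simp only: ennreal_SUP_add_left[OF ne, symmetric] ennreal_SUP_add_right[OF ne, symmetric])
  also have "\<dots> \<le> posvar R \<nu> (A \<union> B)" using * by (intro SUP_least) auto
  finally show ?thesis .
qed

lemma posvar_empty: "posvar R \<nu> {} = 0"
  using R_empty empty by (auto simp: posvar_def intro!: antisym SUP_least)

lemma posvar_mono: "A \<subseteq> B \<Longrightarrow> posvar R \<nu> A \<le> posvar R \<nu> B"
  by (rule posvar_least) (auto intro: posvar_upper)

text \<open>Superadditivity on finite disjoint unions and monotonicity give one inequality. For the
  other, a competitor B from R is cut along the \<open>A i\<close>: the pieces and their union B
  stay in R, even if the union of the \<open>A i\<close> does not.\<close>

lemma posvar_countably_additive: "countably_additive (sets M) (posvar R \<nu>)"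
  unfolding countably_additive_def
proof (intro allI impI antisym)
  fix A :: "nat \<Rightarrow> 'a set"
  assume A: "range A \<subseteq> sets M" "disjoint_family A" "(\<Union>i. A i) \<in> sets M"
  have "(\<Sum>i<n. posvar R \<nu> (A i)) \<le> posvar R \<nu> (\<Union>i<n. A i)" for n
  proof (induction n)
    case (Suc n)
    have "A i \<inter> A n = {}" if "i < n" for i
      using disjoint_family_onD[OF A(2), of i n] that by simp
    then have "(\<Union>i<n. A i) \<inter> A n = {}" by blast
    then have "posvar R \<nu> (\<Union>i<n. A i) + posvar R \<nu> (A n) \<le> posvar R \<nu> ((\<Union>i<n. A i) \<union> A n)"
      by (rule posvar_superadd)
    also have "(\<Union>i<n. A i) \<union> A n = (\<Union>i<Suc n. A i)" by (auto simp: lessThan_Suc)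
    finally have "posvar R \<nu> (\<Union>i<n. A i) + posvar R \<nu> (A n) \<le> posvar R \<nu> (\<Union>i<Suc n. A i)" .
    with add_right_mono[OF Suc] show ?case unfolding sum.lessThan_Suc by (rule order_trans)
  qed (simp add: posvar_empty)
  also have "posvar R \<nu> (\<Union>i<n. A i) \<le> posvar R \<nu> (\<Union>i. A i)" for n
    by (rule posvar_mono) auto
  finally show "(\<Sum>i. posvar R \<nu> (A i)) \<le> posvar R \<nu> (\<Union>i. A i)"
    unfolding suminf_eq_SUP by (intro SUP_least)
  show "posvar R \<nu> (\<Union>i. A i) \<le> (\<Sum>i. posvar R \<nu> (A i))"
  proof (rule posvar_least)
    fix B assume B: "B \<in> R" "B \<subseteq> (\<Union>i. A i)"
    then have B_eq: "(\<Union>i. B \<inter> A i) = B" by blast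
    have "(\<lambda>i. \<nu> (B \<inter> A i)) sums \<nu> (\<Union>i. B \<inter> A i)"
      using A B R_Int by (intro countably_add) (auto simp: B_eq disjoint_family_on_def)
    then have "(\<lambda>n. ennreal (\<Sum>i<n. \<nu> (B \<inter> A i))) \<longlonglongrightarrow> ennreal (\<nu> B)"
      unfolding B_eq sums_def by (rule tendsto_ennrealI)
    moreover have "ennreal (\<Sum>i<n. \<nu> (B \<inter> A i)) \<le> (\<Sum>i. posvar R \<nu> (A i))" for n
    proof -
      have "ennreal (\<Sum>i<n. \<nu> (B \<inter> A i)) \<le> (\<Sum>i<n. ennreal (max 0 (\<nu> (B \<inter> A i))))"
        by (subst sum_ennreal) (auto intro!: ennreal_leI sum_mono)
      also have "\<dots> \<le> (\<Sum>i<n. posvar R \<nu> (A i))"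
      proof (rule sum_mono)
        fix i show "ennreal (max 0 (\<nu> (B \<inter> A i))) \<le> posvar R \<nu> (A i)"
          using posvar_upper[of "B \<inter> A i" "A i"] R_Int[of B "A i"] A B
          by (auto simp: max_def)
      qed
      also have "\<dots> \<le> (\<Sum>i. posvar R \<nu> (A i))" unfolding suminf_eq_SUP by (rule SUP_upper) simp
      finally show ?thesis .
    qed
    ultimately show "ennreal (\<nu> B) \<le> (\<Sum>i. posvar R \<nu> (A i))"
      by (intro LIMSEQ_le_const2) auto
  qed
qed

lemma negvar_eq: "negvar R \<nu> = posvar R (\<lambda>A. - \<nu> A)"
  by (simp add: fun_eq_iff negvar_def posvar_def)

lemmas negvar_upper = delta_ring_measure.posvar_upper[OF uminus, folded negvar_eq]
  and negvar_least = delta_ring_measure.posvar_least[OF uminus, folded negvar_eq]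
  and negvar_empty = delta_ring_measure.posvar_empty[OF uminus, folded negvar_eq]
  and negvar_countably_additive = delta_ring_measure.posvar_countably_additive[OF uminus, folded negvar_eq]

lemma negvar_uminus: "negvar R (\<lambda>A. - \<nu> A) = posvar R \<nu>"
  by (simp add: fun_eq_iff negvar_def posvar_def)

text \<open>If the positive variation were infinite on some set, one could peel off disjoint pieces of
mass at least 1 forever, contradicting summability.\<close>

lemma posvar_infinite_peel:
  assumes A: "A \<in> R" and inf: "posvar R \<nu> A = \<infinity>"
  shows "\<exists>A'\<in>R. A' \<subseteq> A \<and> posvar R \<nu> A' = \<infinity> \<and> 1 \<le> \<bar>\<nu> (A - A')\<bar>"
proof -
  \<comment> \<open>With this threshold both \<nu> B and |\<nu> (A - B)| = |\<nu> A - \<nu> B|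
    exceed 1. Hence whichever of B and \<open>A - B\<close> has infinite variation can be kept, and
    the other one is the peeled piece.\<close>
  have "ennreal (\<bar>\<nu> A\<bar> + 1) < posvar R \<nu> A" by (simp add: inf)
  then obtain B where B: "B \<in> R" "B \<subseteq> A" "ennreal (\<bar>\<nu> A\<bar> + 1) < ennreal (\<nu> B)"
    by (auto simp: posvar_def less_SUP_iff)
  then have big: "\<bar>\<nu> A\<bar> + 1 < \<nu> B" by (simp add: ennreal_less_iff del: ennreal_plus)
  have Bs: "B \<in> sets M" using B R_sets by blast
  have "posvar R \<nu> B + posvar R \<nu> (A - B) = posvar R \<nu> A"
    using additiveD[OF sets.countably_additive_additive[OF _ posvar_countably_additive], of B "A - B"]
      posvar_empty Bs R_sets[OF A] B(2)
    by (simp add: positive_def Un_absorb1)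
  then consider "posvar R \<nu> B = \<infinity>" | "posvar R \<nu> (A - B) = \<infinity>"
    using inf by (metis ennreal_add_eq_top infinity_ennreal_def)
  then show ?thesis
  proof cases
    case 1
    then show ?thesis using B big diff[OF A Bs] by (intro bexI[of _ B]) auto
  next
    case 2
    then show ?thesis using B big R_Diff[OF A Bs]
      by (intro bexI[of _ "A - B"]) (auto simp: double_diff)
  qed
qed

lemma posvar_finite:
  assumes A: "A \<in> R" shows "posvar R \<nu> A < \<infinity>"
proof (rule ccontr)
  assume "\<not> posvar R \<nu> A < \<infinity>"
  then have inf: "posvar R \<nu> A = \<infinity>" by (metis infinity_ennreal_def less_top)
  have "\<exists>F. F 0 = A \<and> (\<forall>n. (F n \<in> R \<and> posvar R \<nu> (F n) = \<infinity>) \<and>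
      F (Suc n) \<subseteq> F n \<and> 1 \<le> \<bar>\<nu> (F n - F (Suc n))\<bar>)"
    using dependent_nat_choice[where P = "\<lambda>n B. B \<in> R \<and> posvar R \<nu> B = \<infinity> \<and> (n = 0 \<longrightarrow> B = A)"
      and Q = "\<lambda>n B B'. B' \<subseteq> B \<and> 1 \<le> \<bar>\<nu> (B - B')\<bar>"]
      A inf posvar_infinite_peel by blast
  then obtain F where F: "F 0 = A" "\<And>n. F n \<in> R" "\<And>n. F (Suc n) \<subseteq> F n"
    "\<And>n. 1 \<le> \<bar>\<nu> (F n - F (Suc n))\<bar>" by blast
  have dec: "decseq F" using F by (auto simp: decseq_Suc_iff)
  define D where "D n = F n - F (Suc n)" for n
  have DR: "D n \<in> R" for n using R_Diff F(2) R_sets by (auto simp: D_def)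
  have "D i \<inter> D j = {}" if "i < j" for i j
    using decseqD[OF dec, of "Suc i" j] that by (auto simp: D_def)
  then have disj: "disjoint_family D"
    unfolding disjoint_family_on_def by (metis Int_commute nat_neq_iff)
  \<comment> \<open>Lying inside A puts the union of the peeled pieces into R, where countable
    additivity applies and forces \<nu> (D n) to tend to 0.\<close>
  have "(\<Union>n. D n) \<subseteq> A" using decseqD[OF dec, of 0] F(1) by (auto simp: D_def)
  then have "(\<Union>n. D n) \<in> R" using DR R_sets by (intro R_subset[OF A]) auto
  then have "(\<lambda>n. \<nu> (D n)) sums \<nu> (\<Union>n. D n)" using DR disj by (intro countably_add) auto
  then have "(\<lambda>n. \<nu> (D n)) \<longlonglongrightarrow> 0" using summable_LIMSEQ_zero sums_summable by blast
  then obtain n where "\<bar>\<nu> (D n)\<bar> < 1" unfolding LIMSEQ_iff by (metis diff_zero order_refl real_norm_def zero_less_one)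
  then show False using F(4)[of n] by (simp add: D_def)
qed

lemmas negvar_finite = delta_ring_measure.posvar_finite[OF uminus, folded negvar_eq]

text \<open>For B inside A, \<nu> B = \<nu> A - \<nu> (A - B) is at most \<nu> A plus the negative
  variation; the supremum over B gives one inequality. It is shown for every measure on R, so
  applying it to -\<nu> gives the other.\<close>

lemma posvar_eq:
  assumes A: "A \<in> R" shows "enn2real (posvar R \<nu> A) = \<nu> A + enn2real (negvar R \<nu> A)"
proof -
  have le: "enn2real (posvar R \<nu> A) \<le> \<nu> A + enn2real (negvar R \<nu> A)"
    if "delta_ring_measure M R \<nu>" for \<nu>
  proof -
    interpret delta_ring_measure M R \<nu> by fact
    have "negvar R \<nu> A < \<infinity>" using A by (rule negvar_finite)
    have nu_le: "\<nu> B \<le> \<nu> A + enn2real (negvar R \<nu> A)" if "B \<in> R" "B \<subseteq> A" for B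
    proof -
      have "ennreal (- \<nu> (A - B)) \<le> negvar R \<nu> A"
        using that A R_sets by (intro negvar_upper R_Diff) auto
      also have "\<dots> = ennreal (enn2real (negvar R \<nu> A))"
        using \<open>negvar R \<nu> A < \<infinity>\<close> by simp
      finally have "- \<nu> (A - B) \<le> enn2real (negvar R \<nu> A)" by (subst (asm) ennreal_le_iff) simp_all
      then show ?thesis using diff[of A B] A that R_sets by simp
    qed
    have "posvar R \<nu> A \<le> ennreal (\<nu> A + enn2real (negvar R \<nu> A))"
      by (intro posvar_least ennreal_leI nu_le)
    then show ?thesis
      using nu_le[OF R_empty] empty by (simp add: enn2real_leI)
  qed
  from le[OF delta_ring_measure_axioms] le[OF uminus] show ?thesis
    by (simp add: negvar_uminus flip: negvar_eq)
qed

section \<open>The variation measures on the sigma-algebra and the Hahn set\<close>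

definition "pos_measure = measure_of (space M) (sets M) (posvar R \<nu>)"
definition "neg_measure = measure_of (space M) (sets M) (negvar R \<nu>)"
abbreviation "tot_measure \<equiv> var_measure M R \<nu>"

lemma sets_pos_measure [simp, measurable_cong]: "sets pos_measure = sets M"
  and sets_neg_measure [simp, measurable_cong]: "sets neg_measure = sets M"
  and sets_tot_measure [simp, measurable_cong]: "sets tot_measure = sets M"
  and space_pos_measure [simp]: "space pos_measure = space M"
  and space_neg_measure [simp]: "space neg_measure = space M"
  and space_tot_measure [simp]: "space tot_measure = space M"
  by (simp_all add: pos_measure_def neg_measure_def var_measure_def)

lemma emeasure_pos: "A \<in> sets M \<Longrightarrow> emeasure pos_measure A = posvar R \<nu> A"
  unfolding pos_measure_def using posvar_countably_additive posvar_empty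
  by (intro emeasure_measure_of_sigma) (auto simp: sets.sigma_algebra_axioms positive_def)

lemma emeasure_neg: "A \<in> sets M \<Longrightarrow> emeasure neg_measure A = negvar R \<nu> A"
  unfolding neg_measure_def using negvar_countably_additive negvar_empty
  by (intro emeasure_measure_of_sigma) (auto simp: sets.sigma_algebra_axioms positive_def)

text \<open>A finite disjoint family is grouped by sign into two unions, which bounds the total
  variation from above. Conversely, competitors C and D for the two variations may overlap, but
  \<nu> C - \<nu> D = \<nu> (C - D) - \<nu> (D - C), so the disjoint sets \<open>C - D\<close> and
  \<open>D - C\<close> do the job.\<close>

lemma totvar_eq: "totvar R \<nu> A = posvar R \<nu> A + negvar R \<nu> A"
proof (rule antisym)
  show "totvar R \<nu> A \<le> posvar R \<nu> A + negvar R \<nu> A"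
    unfolding totvar_def
  proof (rule SUP_least, clarify)
    fix P assume P: "finite P" "P \<subseteq> R" "disjoint P" "\<forall>B\<in>P. B \<subseteq> A"
    define Q where "Q = {B \<in> P. 0 \<le> \<nu> B}"
    have Q: "finite Q" "Q \<subseteq> R" "disjoint Q" "finite (P - Q)" "P - Q \<subseteq> R" "disjoint (P - Q)"
      using P by (auto simp: Q_def disjoint_def)
    have "(\<Sum>B\<in>P. \<bar>\<nu> B\<bar>) = (\<Sum>B\<in>Q. \<bar>\<nu> B\<bar>) + (\<Sum>B\<in>P - Q. \<bar>\<nu> B\<bar>)"
      using P by (subst sum.subset_diff[of Q]) (auto simp: Q_def)
    also have "(\<Sum>B\<in>Q. \<bar>\<nu> B\<bar>) = \<nu> (\<Union>Q)"
      unfolding finite_add[OF Q(1-3)] by (intro sum.cong) (auto simp: Q_def)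
    also have "(\<Sum>B\<in>P - Q. \<bar>\<nu> B\<bar>) = - \<nu> (\<Union>(P - Q))"
      unfolding finite_add[OF Q(4-6)] sum_negf[symmetric] by (intro sum.cong) (auto simp: Q_def)
    finally have "ennreal (\<Sum>B\<in>P. \<bar>\<nu> B\<bar>) \<le> ennreal (max 0 (\<nu> (\<Union>Q)) + max 0 (- \<nu> (\<Union>(P - Q))))"
      by (intro ennreal_leI) linarith
    also have "\<dots> = ennreal (max 0 (\<nu> (\<Union>Q))) + ennreal (max 0 (- \<nu> (\<Union>(P - Q))))"
      by (rule ennreal_plus) auto
    also have "\<dots> = ennreal (\<nu> (\<Union>Q)) + ennreal (- \<nu> (\<Union>(P - Q)))"
      by (simp add: max_def ennreal_neg)
    also have "\<dots> \<le> posvar R \<nu> A + negvar R \<nu> A"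
      using P Q by (intro add_mono posvar_upper negvar_upper R_finite_Union) (auto simp: Q_def)
    finally show "ennreal (\<Sum>B\<in>P. \<bar>\<nu> B\<bar>) \<le> posvar R \<nu> A + negvar R \<nu> A" .
  qed
  have upper: "ennreal (\<Sum>B\<in>P. \<bar>\<nu> B\<bar>) \<le> totvar R \<nu> A"
    if "finite P" "P \<subseteq> R" "disjoint P" "\<forall>B\<in>P. B \<subseteq> A" for P
    unfolding totvar_def using that by (intro SUP_upper) auto
  have *: "ennreal (\<nu> C) + ennreal (- \<nu> D) \<le> totvar R \<nu> A"
    if CD: "C \<in> R" "C \<subseteq> A" "D \<in> R" "D \<subseteq> A" for C D
  proof -
    consider "\<nu> C \<ge> 0" "\<nu> D \<le> 0" | "\<nu> C < 0" | "\<nu> D > 0" by linarith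
    then show ?thesis
    proof cases
      case 1
      have s: "C \<in> sets M" "D \<in> sets M" using CD R_sets by auto
      \<comment> \<open>The two-element family collapses only if both differences are empty, and
        then the sum over it is 0 on either reading.\<close>
      have "C - D \<noteq> D - C \<or> C - D = {} \<and> D - C = {}" by blast
      then have "(\<Sum>B\<in>{C - D, D - C}. \<bar>\<nu> B\<bar>) = \<bar>\<nu> (C - D)\<bar> + \<bar>\<nu> (D - C)\<bar>"
        by (metis (no_types, lifting) abs_zero add.right_neutral empty finite.intros(1) insert_absorb2
            singleton_iff sum.empty sum.insert finite_insert empty_iff)
      moreover have "\<nu> C - \<nu> D = \<nu> (C - D) - \<nu> (D - C)"
        using split[OF CD(1) s(2)] split[OF CD(3) s(1)] by (simp add: Int_commute)
      ultimately have "\<nu> C - \<nu> D \<le> (\<Sum>B\<in>{C - D, D - C}. \<bar>\<nu> B\<bar>)" by linarith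
      then have "ennreal (\<nu> C) + ennreal (- \<nu> D) \<le> ennreal (\<Sum>B\<in>{C - D, D - C}. \<bar>\<nu> B\<bar>)"
        using 1 by (subst ennreal_plus[symmetric]) (auto simp del: ennreal_plus intro!: ennreal_leI)
      also have "\<dots> \<le> totvar R \<nu> A"
        using CD s R_Diff by (intro upper) (auto simp: disjoint_def)
      finally show ?thesis .
    next
      case 2
      have "ennreal (- \<nu> D) \<le> ennreal \<bar>\<nu> D\<bar>" by (intro ennreal_leI abs_ge_minus_self)
      also have "\<dots> \<le> totvar R \<nu> A" using upper[of "{D}"] CD by simp
      finally show ?thesis using 2 by (simp add: ennreal_neg)
    next
      case 3
      have "ennreal (\<nu> C) \<le> ennreal \<bar>\<nu> C\<bar>" by (intro ennreal_leI abs_ge_self)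
      also have "\<dots> \<le> totvar R \<nu> A" using upper[of "{C}"] CD by simp
      finally show ?thesis using 3 by (simp add: ennreal_neg)
    qed
  qed
  have ne: "{B \<in> R. B \<subseteq> A} \<noteq> {}" for A using R_empty by auto
  have "posvar R \<nu> A + negvar R \<nu> A =
     (SUP C\<in>{C \<in> R. C \<subseteq> A}. SUP D\<in>{D \<in> R. D \<subseteq> A}. ennreal (\<nu> C) + ennreal (- \<nu> D))"
    unfolding posvar_def negvar_def by (simp only: ennreal_SUP_add_left[OF ne, symmetric] ennreal_SUP_add_right[OF ne, symmetric])
  also have "\<dots> \<le> totvar R \<nu> A" using * by (intro SUP_least) auto
  finally show "posvar R \<nu> A + negvar R \<nu> A \<le> totvar R \<nu> A" .
qed

lemma emeasure_tot:
  assumes "A \<in> sets M" shows "emeasure tot_measure A = posvar R \<nu> A + negvar R \<nu> A"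
proof -
  have "countably_additive (sets M) (totvar R \<nu>)"
    using posvar_countably_additive negvar_countably_additive
    by (auto simp: countably_additive_def totvar_eq simp flip: suminf_add)
  moreover have "positive (sets M) (totvar R \<nu>)"
    by (simp add: positive_def totvar_eq posvar_empty negvar_empty)
  ultimately show ?thesis
    unfolding var_measure_def using assms
    by (subst emeasure_measure_of_sigma) (auto simp: sets.sigma_algebra_axioms totvar_eq)
qed

lemma pos_le_tot: "pos_measure \<le> tot_measure"
  and neg_le_tot: "neg_measure \<le> tot_measure"
  by (auto simp: le_measure le_fun_def emeasure_pos emeasure_neg emeasure_tot emeasure_notin_sets)

lemma integrable_tot_imp:
  fixes f :: "'a \<Rightarrow> real"
  assumes "integrable tot_measure f"
  shows "integrable pos_measure f" "integrable neg_measure f"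
proof -
  have f: "f \<in> borel_measurable M" "(\<integral>\<^sup>+x. norm (f x) \<partial>tot_measure) < \<infinity>"
    using assms by (auto simp: integrable_iff_bounded cong: measurable_cong_sets)
  show "integrable pos_measure f" "integrable neg_measure f"
    using f nn_integral_mono_measure[OF _ pos_le_tot, of "\<lambda>x. norm (f x)"]
      nn_integral_mono_measure[OF _ neg_le_tot, of "\<lambda>x. norm (f x)"]
    by (auto simp: integrable_iff_bounded cong: measurable_cong_sets)
qed

text \<open>Both variations are finite on each cover set \<open>\<Omega> n\<close>, so the Hahn
  decomposition for two measures gives a local set \<open>Y n\<close>. Using \<open>Y n\<close> only
  on the n-th disjointed piece prevents conflicts between the choices, and countable additivity over
  the pieces transfers the signs to all of R.\<close>

lemma Hahn_decomposition:
  obtains P where "P \<in> sets M"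
    "\<And>A. A \<in> R \<Longrightarrow> 0 \<le> \<nu> (A \<inter> P)" "\<And>A. A \<in> R \<Longrightarrow> \<nu> (A - P) \<le> 0"
    "\<And>A. A \<in> R \<Longrightarrow> posvar R \<nu> A = ennreal (\<nu> (A \<inter> P))"
    "\<And>A. A \<in> R \<Longrightarrow> negvar R \<nu> A = ennreal (- \<nu> (A - P))"
proof -
  obtain \<Omega> :: "nat \<Rightarrow> 'a set" where \<Omega>: "range \<Omega> \<subseteq> R" "(\<Union>n. \<Omega> n) = space M"
    using R_cover by blast
  have \<Omega>R: "\<Omega> n \<in> R" for n using \<Omega> by auto
  have "\<exists>Y\<in>sets M. Y \<subseteq> \<Omega> n \<and> (\<forall>B\<in>R. B \<subseteq> Y \<longrightarrow> 0 \<le> \<nu> B) \<and>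
     (\<forall>B\<in>R. B \<subseteq> \<Omega> n \<longrightarrow> B \<inter> Y = {} \<longrightarrow> \<nu> B \<le> 0)" for n
  proof -
    have "\<exists>Y\<in>sets pos_measure. Y \<subseteq> \<Omega> n
      \<and> (\<forall>X\<in>sets pos_measure. X \<subseteq> Y \<longrightarrow> emeasure neg_measure X \<le> emeasure pos_measure X)
      \<and> (\<forall>X\<in>sets pos_measure. X \<subseteq> \<Omega> n \<longrightarrow> X \<inter> Y = {} \<longrightarrow> emeasure pos_measure X \<le> emeasure neg_measure X)"
      using \<Omega>R R_sets posvar_finite[OF \<Omega>R] negvar_finite[OF \<Omega>R]
      by (intro unsigned_Hahn_decomposition) (auto simp: emeasure_pos emeasure_neg less_top)
    then obtain Y where Y: "Y \<in> sets M" "Y \<subseteq> \<Omega> n"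
      "\<And>X. X \<in> sets M \<Longrightarrow> X \<subseteq> Y \<Longrightarrow> negvar R \<nu> X \<le> posvar R \<nu> X"
      "\<And>X. X \<in> sets M \<Longrightarrow> X \<subseteq> \<Omega> n \<Longrightarrow> X \<inter> Y = {} \<Longrightarrow> posvar R \<nu> X \<le> negvar R \<nu> X"
      by (auto simp: emeasure_pos emeasure_neg)
    \<comment> \<open>On R, \<nu> is the difference of its finite variations by
      \<open>posvar_eq\<close>, so comparing the variations gives the sign of \<nu>.\<close>
    have "0 \<le> \<nu> B" if "B \<in> R" "B \<subseteq> Y" for B
      using enn2real_mono[OF Y(3)[OF R_sets that(2)] posvar_finite[unfolded infinity_ennreal_def]]
        posvar_eq[of B] that by auto
    moreover have "\<nu> B \<le> 0" if "B \<in> R" "B \<subseteq> \<Omega> n" "B \<inter> Y = {}" for B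
      using enn2real_mono[OF Y(4)[OF R_sets that(2,3)] negvar_finite[unfolded infinity_ennreal_def]]
        posvar_eq[of B] that by auto
    ultimately show ?thesis using Y(1,2) by blast
  qed
  then obtain Y where Y: "\<And>n. Y n \<in> sets M" "\<And>n. Y n \<subseteq> \<Omega> n"
    "\<And>n B. B \<in> R \<Longrightarrow> B \<subseteq> Y n \<Longrightarrow> 0 \<le> \<nu> B"
    "\<And>n B. B \<in> R \<Longrightarrow> B \<subseteq> \<Omega> n \<Longrightarrow> B \<inter> Y n = {} \<Longrightarrow> \<nu> B \<le> 0"
    by metis
  define P where "P = (\<Union>n. Y n \<inter> disjointed \<Omega> n)"
  have "range \<Omega> \<subseteq> sets M" using \<Omega>R R_sets by auto
  then have D: "disjointed \<Omega> n \<in> sets M" for n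
    using sets.range_disjointed_sets by blast
  have DP: "disjointed \<Omega> n \<inter> P = disjointed \<Omega> n \<inter> Y n" for n
  proof -
    have "disjointed \<Omega> n \<inter> disjointed \<Omega> k = {}" if "k \<noteq> n" for k
      using disjoint_family_onD[OF disjoint_family_disjointed[of \<Omega>], of n k] that by simp
    then have "k = n" if "x \<in> disjointed \<Omega> n" "x \<in> disjointed \<Omega> k" for k x
      using that by blast
    then show ?thesis unfolding P_def by blast
  qed
  have P: "P \<in> sets M" unfolding P_def using Y(1) D by auto
  have sums: "(\<lambda>n. \<nu> (A \<inter> disjointed \<Omega> n)) sums \<nu> A" if A: "A \<in> R" for A
  proof -
    have "(\<Union>n. A \<inter> disjointed \<Omega> n) = A"
      using \<Omega>(2) R_sets[OF A] sets.sets_into_space UN_disjointed_eq[of \<Omega>] by fastforce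
    then show ?thesis using countably_add[of "\<lambda>n. A \<inter> disjointed \<Omega> n"] A R_Int D disjoint_family_disjointed[of \<Omega>]
      by (fastforce simp: disjoint_family_on_def)
  qed
  have pos: "0 \<le> \<nu> A" if "A \<in> R" "A \<subseteq> P" for A
  proof -
    have "0 \<le> \<nu> (A \<inter> disjointed \<Omega> n)" for n
      using that DP[of n] by (intro Y(3)[of _ n] R_Int D) auto
    then show ?thesis using sums_le[OF _ sums_zero sums[OF that(1)]] by auto
  qed
  have neg: "\<nu> A \<le> 0" if "A \<in> R" "A \<inter> P = {}" for A
  proof -
    have "\<nu> (A \<inter> disjointed \<Omega> n) \<le> 0" for n
      using that DP[of n] disjointed_subset[of \<Omega> n] by (intro Y(4)[of _ n] R_Int D) auto
    then show ?thesis using sums_le[OF _ sums[OF that(1)] sums_zero] by auto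
  qed
  show ?thesis
  proof
    show "P \<in> sets M" by fact
    fix A assume A: "A \<in> R"
    show "0 \<le> \<nu> (A \<inter> P)" "\<nu> (A - P) \<le> 0" using pos[OF R_Int[OF A P]] neg[OF R_Diff[OF A P]] by auto
    show "posvar R \<nu> A = ennreal (\<nu> (A \<inter> P))"
    proof (intro antisym posvar_least ennreal_leI)
      fix B assume B: "B \<in> R" "B \<subseteq> A"
      \<comment> \<open>Dropping B - P, where \<nu> is nonpositive, and then filling up to A
        \<inter> P, where it is nonnegative, can only raise \<nu>. So A \<inter> P attains the
        supremum.\<close>
      have "\<nu> B \<le> \<nu> (B \<inter> P)" using split[OF B(1) P] neg[OF R_Diff[OF B(1) P]] by auto
      also have "\<dots> \<le> \<nu> (A \<inter> P)"
        using diff[of "A \<inter> P" "B \<inter> P"] pos[of "A \<inter> P - B \<inter> P"] A B P R_Int R_Diff R_sets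
        by (simp add: le_infI1 Diff_subset_conv)
      finally show "\<nu> B \<le> \<nu> (A \<inter> P)" .
    qed (use A P R_Int in \<open>auto intro: posvar_upper\<close>)
    show "negvar R \<nu> A = ennreal (- \<nu> (A - P))"
    proof (intro antisym negvar_least ennreal_leI)
      fix B assume B: "B \<in> R" "B \<subseteq> A"
      have "- \<nu> B \<le> - \<nu> (B - P)" using split[OF B(1) P] pos[OF R_Int[OF B(1) P]] by auto
      also have "\<dots> \<le> - \<nu> (A - P)"
        using diff[of "A - P" "B - P"] neg[of "(A - P) - (B - P)"] A B P R_Int R_Diff R_sets
        by (auto simp: Diff_mono)
      finally show "- \<nu> B \<le> - \<nu> (A - P)" .
    qed (use A P R_Diff in \<open>auto intro: negvar_upper\<close>)
  qed
qed

end

section \<open>Order continuous functionals as integrals\<close>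

text \<open>L stands for \<phi> \<circ> T. R is a separate parameter because it may be smaller than
  the family of all sets with indicator in Y: in the optimality argument Y belongs to Z while R
  comes from X. Order and convergence are pointwise on the space, so no null sets enter.\<close>

locale order_cont_functional =
  fixes M :: "'a measure" and R :: "'a set set" and Y :: "('a \<Rightarrow> real) set"
    and L :: "('a \<Rightarrow> real) \<Rightarrow> real"
  assumes R_sets: "A \<in> R \<Longrightarrow> A \<in> sets M"
    and R_subset: "A \<in> R \<Longrightarrow> B \<in> sets M \<Longrightarrow> B \<subseteq> A \<Longrightarrow> B \<in> R"
    and R_Un: "A \<in> R \<Longrightarrow> B \<in> R \<Longrightarrow> A \<union> B \<in> R"
    and R_cover: "\<exists>\<Omega>::nat \<Rightarrow> 'a set. range \<Omega> \<subseteq> R \<and> (\<Union>n. \<Omega> n) = space M"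
    and R_indicator: "A \<in> R \<Longrightarrow> indicator A \<in> Y"
    and Y_measurable: "f \<in> Y \<Longrightarrow> f \<in> borel_measurable M"
    and Y_zero: "(\<lambda>x. 0) \<in> Y"
    and Y_add: "f \<in> Y \<Longrightarrow> g \<in> Y \<Longrightarrow> (\<lambda>x. f x + g x) \<in> Y"
    and Y_scale: "f \<in> Y \<Longrightarrow> (\<lambda>x. c * f x) \<in> Y"
    and Y_ideal: "f \<in> Y \<Longrightarrow> g \<in> borel_measurable M \<Longrightarrow>
      (\<And>x. x \<in> space M \<Longrightarrow> \<bar>g x\<bar> \<le> \<bar>f x\<bar>) \<Longrightarrow> g \<in> Y"
    and L_add: "f \<in> Y \<Longrightarrow> g \<in> Y \<Longrightarrow> L (\<lambda>x. f x + g x) = L f + L g"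
    and L_scale: "f \<in> Y \<Longrightarrow> L (\<lambda>x. c * f x) = c * L f"
    and L_cong: "f \<in> Y \<Longrightarrow> g \<in> Y \<Longrightarrow> (\<And>x. x \<in> space M \<Longrightarrow> f x = g x) \<Longrightarrow> L f = L g"
    and L_cont: "\<And>fs f. (\<And>n::nat. fs n \<in> Y) \<Longrightarrow> f \<in> Y \<Longrightarrow>
      (\<And>n x. x \<in> space M \<Longrightarrow> 0 \<le> fs n x \<and> fs n x \<le> fs (Suc n) x) \<Longrightarrow>
      (\<And>x. x \<in> space M \<Longrightarrow> (\<lambda>n. fs n x) \<longlonglongrightarrow> f x) \<Longrightarrow> (\<lambda>n. L (fs n)) \<longlonglongrightarrow> L f"
begin

lemma L_zero: "L (\<lambda>x. 0) = 0"
  using L_scale[OF Y_zero, of 0] by simp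

lemma Y_sum: "finite I \<Longrightarrow> (\<And>i. i \<in> I \<Longrightarrow> f i \<in> Y) \<Longrightarrow> (\<lambda>x. \<Sum>i\<in>I. f i x) \<in> Y"
  by (induction rule: finite_induct) (auto simp: Y_zero Y_add)

lemma L_sum: "finite I \<Longrightarrow> (\<And>i. i \<in> I \<Longrightarrow> f i \<in> Y) \<Longrightarrow> L (\<lambda>x. \<Sum>i\<in>I. f i x) = (\<Sum>i\<in>I. L (f i))"
  by (induction rule: finite_induct) (simp_all add: L_zero L_add Y_sum)

text \<open>The partial sums of the indicators of disjoint sets increase to the indicator of their
  union, so order continuity of L becomes countable additivity.\<close>

lemma delta_ring_measure: "delta_ring_measure M R (\<lambda>A. L (indicator A))"
proof
  show "\<exists>\<Omega>::nat \<Rightarrow> 'a set. range \<Omega> \<subseteq> R \<and> (\<Union>n. \<Omega> n) = space M" by (rule R_cover)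
  fix A :: "nat \<Rightarrow> 'a set"
  assume A: "range A \<subseteq> R" "disjoint_family A" "(\<Union>n. A n) \<in> R"
  then have AR: "A n \<in> R" for n by auto
  have lim: "(\<lambda>i. indicator (A i) x :: real) sums indicator (\<Union>i. A i) x" for x
    using A(2) by (intro indicator_sums) (simp add: disjoint_family_on_def)
  have "(\<lambda>n. L (\<lambda>x. \<Sum>i<n. indicator (A i) x)) \<longlonglongrightarrow> L (indicator (\<Union>i. A i))"
    using lim by (intro L_cont Y_sum R_indicator AR A) (auto simp: sums_def sum_nonneg)
  then show "(\<lambda>n. L (indicator (A n))) sums L (indicator (\<Union>n. A n))"
    unfolding sums_def by (simp add: L_sum R_indicator AR)
qed (fact R_sets R_subset R_Un)+

sublocale \<nu>: delta_ring_measure M R "\<lambda>A. L (indicator A)"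
  by (rule delta_ring_measure)

lemma Y_restrict: "f \<in> Y \<Longrightarrow> P \<in> sets M \<Longrightarrow> (\<lambda>x. indicator P x * f x) \<in> Y"
  using Y_measurable by (intro Y_ideal[of f "\<lambda>x. indicator P x * f x"]) (auto simp: indicator_def)

text \<open>The factor c serves both parts of L: c = 1 on a Hahn set and c = -1 on its complement
  make both restrictions nonnegative on indicators from R.\<close>

lemma restrict:
  assumes P: "P \<in> sets M"
  shows "order_cont_functional M R Y (\<lambda>f. c * L (\<lambda>x. indicator P x * f x))"
proof
  fix f g assume fg: "f \<in> Y" "g \<in> Y"
  show "c * L (\<lambda>x. indicator P x * (f x + g x)) =
      c * L (\<lambda>x. indicator P x * f x) + c * L (\<lambda>x. indicator P x * g x)"
    using L_add[OF Y_restrict Y_restrict, OF fg(1) P fg(2) P] by (simp add: algebra_simps)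
  show "c * L (\<lambda>x. indicator P x * (d * f x)) = d * (c * L (\<lambda>x. indicator P x * f x))" for d
    using L_scale[OF Y_restrict, OF fg(1) P] by (simp add: algebra_simps)
  assume "\<And>x. x \<in> space M \<Longrightarrow> f x = g x"
  then show "c * L (\<lambda>x. indicator P x * f x) = c * L (\<lambda>x. indicator P x * g x)"
    using fg P by (intro arg_cong[where f = "\<lambda>t. c * t"] L_cong Y_restrict) auto
next
  fix fs :: "nat \<Rightarrow> 'a \<Rightarrow> real" and f
  assume f: "\<And>n. fs n \<in> Y" "f \<in> Y"
    "\<And>n x. x \<in> space M \<Longrightarrow> 0 \<le> fs n x \<and> fs n x \<le> fs (Suc n) x"
    "\<And>x. x \<in> space M \<Longrightarrow> (\<lambda>n. fs n x) \<longlonglongrightarrow> f x"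
  then show "(\<lambda>n. c * L (\<lambda>x. indicator P x * fs n x)) \<longlonglongrightarrow> c * L (\<lambda>x. indicator P x * f x)"
    using P by (intro tendsto_mult_left L_cont Y_restrict) (auto simp: indicator_def)
qed (fact R_sets R_subset R_Un R_cover R_indicator Y_measurable Y_zero Y_add Y_scale Y_ideal | assumption)+

lemma plus:
  assumes "order_cont_functional M R Y L'"
  shows "order_cont_functional M R Y (\<lambda>f. L f + L' f)"
proof -
  interpret L': order_cont_functional M R Y L' by fact
  show ?thesis
  proof
    fix f g assume fg: "f \<in> Y" "g \<in> Y"
    show "L (\<lambda>x. f x + g x) + L' (\<lambda>x. f x + g x) = L f + L' f + (L g + L' g)"
      by (simp add: L_add L'.L_add fg)
    show "L (\<lambda>x. d * f x) + L' (\<lambda>x. d * f x) = d * (L f + L' f)" for d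
      by (simp add: L_scale L'.L_scale fg algebra_simps)
    assume "\<And>x. x \<in> space M \<Longrightarrow> f x = g x"
    then show "L f + L' f = L g + L' g" using L_cong[OF fg] L'.L_cong[OF fg] by simp
  next
    fix fs :: "nat \<Rightarrow> 'a \<Rightarrow> real" and f
    assume f: "\<And>n. fs n \<in> Y" "f \<in> Y"
      "\<And>n x. x \<in> space M \<Longrightarrow> 0 \<le> fs n x \<and> fs n x \<le> fs (Suc n) x"
      "\<And>x. x \<in> space M \<Longrightarrow> (\<lambda>n. fs n x) \<longlonglongrightarrow> f x"
    then show "(\<lambda>n. L (fs n) + L' (fs n)) \<longlonglongrightarrow> L f + L' f"
      by (intro tendsto_add L_cont L'.L_cont) auto
  qed (fact R_sets R_subset R_Un R_cover R_indicator Y_measurable Y_zero Y_add Y_scale Y_ideal | assumption)+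
qed

text \<open>Cutting the usual simple functions off outside finite unions of cover sets places the
  level sets of nonzero values in R. Outside the space the cut functions vanish, hence the factor
  \<open>indicator (space M) x\<close> in the limit.\<close>

lemma simple_approximation:
  assumes f: "f \<in> Y" and nonneg: "\<And>x. 0 \<le> f x"
  obtains s where "\<And>n::nat. simple_function M (s n)" "\<And>n. s n \<in> Y"
    "\<And>n x. 0 \<le> s n x" "\<And>n x. s n x \<le> s (Suc n) x"
    "\<And>x. (\<lambda>n. s n x) \<longlonglongrightarrow> indicator (space M) x * f x"
    "\<And>n y. y \<noteq> 0 \<Longrightarrow> s n -` {y} \<inter> space M \<in> R"
proof -
  have fM: "f \<in> borel_measurable M" using f by (rule Y_measurable)
  obtain \<Omega> :: "nat \<Rightarrow> 'a set" where \<Omega>: "range \<Omega> \<subseteq> R" "(\<Union>n. \<Omega> n) = space M"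
    using R_cover by blast
  define B where "B n = (\<Union>i\<le>n. \<Omega> i)" for n
  have BR: "B n \<in> R" for n
    unfolding B_def using \<Omega>(1) by (intro \<nu>.R_finite_Union) auto
  obtain g where g: "incseq g" "\<And>i. simple_function M (g i)" "\<And>x. bdd_above (range (\<lambda>i. g i x))"
    "\<And>i x. 0 \<le> g i x" "f = (SUP i. g i)"
    using borel_measurable_implies_simple_function_sequence_real[OF fM nonneg] by blast
  have f_eq: "f x = (SUP i. g i x)" for x using g(5) by (simp add: image_comp)
  have g_inc: "g i x \<le> g (Suc i) x" for i x using g(1) by (simp add: incseq_Suc_iff le_fun_def)
  have g_le: "g i x \<le> f x" for i x unfolding f_eq by (intro cSUP_upper g(3)) auto
  have g_lim: "(\<lambda>i. g i x) \<longlonglongrightarrow> f x" for x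
    unfolding f_eq using g_inc g(3) by (intro LIMSEQ_incseq_SUP) (auto simp: incseq_Suc_iff)
  define s where "s n x = indicator (B n) x * g n x" for n x
  have simple: "simple_function M (s n)" for n
    unfolding s_def using BR R_sets g(2) by (intro simple_function_mult simple_function_indicator) auto
  show ?thesis
  proof
    fix n x
    show "simple_function M (s n)" by (rule simple)
    show "0 \<le> s n x" using g(4) by (simp add: s_def)
    show "s n x \<le> s (Suc n) x"
      using g_inc[of n x] g(4)[of "Suc n" x] by (auto simp: s_def B_def indicator_def atMost_Suc)
    show "s n \<in> Y"
    proof (rule Y_ideal[OF f])
      show "s n \<in> borel_measurable M" using simple by (rule borel_measurable_simple_function)
      show "\<bar>s n x\<bar> \<le> \<bar>f x\<bar>" for x
        using g_le[of n x] g(4)[of n x] by (auto simp: s_def indicator_def)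
    qed
    show "(\<lambda>n. s n x) \<longlonglongrightarrow> indicator (space M) x * f x"
    proof (cases "x \<in> space M")
      case True
      then obtain k where "x \<in> \<Omega> k" using \<Omega>(2) by blast
      then have "eventually (\<lambda>n. g n x = s n x) sequentially"
        unfolding eventually_sequentially by (intro exI[of _ k]) (auto simp: s_def B_def indicator_def)
      with g_lim[of x] show ?thesis using True by (auto intro: Lim_transform_eventually)
    next
      case False
      then have "s n x = 0" for n using R_sets[OF BR, of n] sets.sets_into_space by (force simp: s_def)
      with False show ?thesis by simp
    qed
    fix y :: real assume "y \<noteq> 0"
    then have "s n -` {y} \<inter> space M \<subseteq> B n" by (auto simp: s_def indicator_def split: if_splits)
    then show "s n -` {y} \<inter> space M \<in> R"
      by (rule R_subset[OF BR simple_functionD(2)[OF simple]])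
  qed
qed

text \<open>Both sides agree on simple functions over R, where \<kappa> is prescribed. Monotone
  convergence on the left and order continuity of L on the right then reach f.\<close>

lemma nn_integral_eq:
  assumes \<kappa>: "sets \<kappa> = sets M"
    "\<And>A. A \<in> R \<Longrightarrow> 0 \<le> L (indicator A)"
    "\<And>A. A \<in> R \<Longrightarrow> emeasure \<kappa> A = ennreal (L (indicator A))"
    and f: "f \<in> Y" and nonneg: "\<And>x. 0 \<le> f x"
  shows "0 \<le> L f" "(\<integral>\<^sup>+x. ennreal (f x) \<partial>\<kappa>) = ennreal (L f)"
proof -
  have sp: "space \<kappa> = space M" using \<kappa>(1) by (rule sets_eq_imp_space_eq)
  obtain s where s: "\<And>n::nat. simple_function M (s n)" "\<And>n. s n \<in> Y"
    "\<And>n x. 0 \<le> s n x" "\<And>n x. s n x \<le> s (Suc n) x"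
    "\<And>x. (\<lambda>n. s n x) \<longlonglongrightarrow> indicator (space M) x * f x"
    and sR: "\<And>n y. y \<noteq> 0 \<Longrightarrow> s n -` {y} \<inter> space M \<in> R"
    using simple_approximation[OF f nonneg] by blast
  have step: "0 \<le> L (s n) \<and> (\<integral>\<^sup>+x. ennreal (s n x) \<partial>\<kappa>) = ennreal (L (s n))" for n
  proof -
    \<comment> \<open>The value 0 is left out because its level set may lie outside R.\<close>
    let ?I = "s n ` space M - {0}"
    let ?C = "\<lambda>y. s n -` {y} \<inter> space M"
    have fin: "finite ?I" using s(1) by (simp add: simple_functionD(1))
    have eq: "s n x = (\<Sum>y\<in>?I. y * indicator (?C y) x)" if "x \<in> space M" for x
    proof -
      have "s n x = (\<Sum>y\<in>s n ` space M. y * indicator (?C y) x)"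
        by (rule simple_function_indicator_representation_real[OF s(1) that s(3)])
      also have "\<dots> = (\<Sum>y\<in>?I. y * indicator (?C y) x)"
        using s(1) by (intro sum.mono_neutral_right) (auto simp: simple_functionD(1))
      finally show ?thesis .
    qed
    have C: "y \<in> ?I \<Longrightarrow> ?C y \<in> R" for y using sR by simp
    have nn: "y \<in> ?I \<Longrightarrow> 0 \<le> y" for y using s(3) by auto
    have Y: "y \<in> ?I \<Longrightarrow> (\<lambda>x. y * indicator (?C y) x) \<in> Y" for y
      by (intro Y_scale R_indicator C)
    have "L (s n) = L (\<lambda>x. \<Sum>y\<in>?I. y * indicator (?C y) x)"
      by (rule L_cong[OF s(2) Y_sum[OF fin Y] eq])
    also have "\<dots> = (\<Sum>y\<in>?I. L (\<lambda>x. y * indicator (?C y) x))"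
      by (rule L_sum[OF fin Y])
    also have "\<dots> = (\<Sum>y\<in>?I. y * L (indicator (?C y)))"
      by (intro sum.cong refl L_scale R_indicator C)
    finally have L_eq: "L (s n) = (\<Sum>y\<in>?I. y * L (indicator (?C y)))" .
    have "(\<integral>\<^sup>+x. ennreal (s n x) \<partial>\<kappa>) = (\<integral>\<^sup>+x. (\<Sum>y\<in>?I. ennreal y * indicator (?C y) x) \<partial>\<kappa>)"
    proof (rule nn_integral_cong)
      fix x assume "x \<in> space \<kappa>"
      then have "x \<in> space M" by (simp only: sp)
      then have "ennreal (s n x) = ennreal (\<Sum>y\<in>?I. y * indicator (?C y) x)" by (rule arg_cong[OF eq])
      also have "\<dots> = (\<Sum>y\<in>?I. ennreal (y * indicator (?C y) x))"
        using nn by (intro sum_ennreal[symmetric]) (auto simp: indicator_def)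
      also have "\<dots> = (\<Sum>y\<in>?I. ennreal y * indicator (?C y) x)"
        by (intro sum.cong refl) (auto simp: indicator_def)
      finally show "ennreal (s n x) = (\<Sum>y\<in>?I. ennreal y * indicator (?C y) x)" .
    qed
    also have "\<dots> = (\<Sum>y\<in>?I. \<integral>\<^sup>+x. ennreal y * indicator (?C y) x \<partial>\<kappa>)"
      using R_sets[OF C] \<kappa>(1) by (intro nn_integral_sum) auto
    also have "\<dots> = (\<Sum>y\<in>?I. ennreal y * emeasure \<kappa> (?C y))"
      using R_sets[OF C] \<kappa>(1) by (intro sum.cong refl nn_integral_cmult_indicator) auto
    also have "\<dots> = (\<Sum>y\<in>?I. ennreal (y * L (indicator (?C y))))"
      using nn \<kappa>(2,3)[OF C] by (intro sum.cong refl) (simp add: ennreal_mult)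
    also have "\<dots> = ennreal (L (s n))"
      unfolding L_eq using nn \<kappa>(2)[OF C] by (intro sum_ennreal) (simp add: mult_nonneg_nonneg)
    finally have "(\<integral>\<^sup>+x. ennreal (s n x) \<partial>\<kappa>) = ennreal (L (s n))" .
    moreover have "0 \<le> L (s n)"
      unfolding L_eq using nn \<kappa>(2)[OF C] by (intro sum_nonneg) (simp add: mult_nonneg_nonneg)
    ultimately show ?thesis by simp
  qed
  have "(\<lambda>n. s n x) \<longlonglongrightarrow> f x" if "x \<in> space M" for x using s(5)[of x] that by simp
  then have lim: "(\<lambda>n. L (s n)) \<longlonglongrightarrow> L f"
    using s(3,4) by (intro L_cont s(2) f) auto
  show "0 \<le> L f" using lim step by (intro LIMSEQ_le_const[OF lim]) auto
  have "(\<lambda>n. \<integral>\<^sup>+x. ennreal (s n x) \<partial>\<kappa>) \<longlonglongrightarrow> (\<integral>\<^sup>+x. ennreal (indicator (space M) x * f x) \<partial>\<kappa>)"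
  proof (rule nn_integral_LIMSEQ)
    show "incseq (\<lambda>n x. ennreal (s n x))" using s(4) by (auto simp: incseq_Suc_iff le_fun_def ennreal_leI)
    show "(\<lambda>x. ennreal (s n x)) \<in> borel_measurable \<kappa>" for n
      using borel_measurable_simple_function[OF s(1)] \<kappa>(1) by (simp cong: measurable_cong_sets)
    show "(\<lambda>n. ennreal (s n x)) \<longlonglongrightarrow> ennreal (indicator (space M) x * f x)" for x
      by (intro tendsto_ennrealI s(5))
  qed
  moreover have "(\<integral>\<^sup>+x. ennreal (indicator (space M) x * f x) \<partial>\<kappa>) = (\<integral>\<^sup>+x. ennreal (f x) \<partial>\<kappa>)"
    by (rule nn_integral_cong) (simp add: sp)
  moreover have "(\<lambda>n. \<integral>\<^sup>+x. ennreal (s n x) \<partial>\<kappa>) \<longlonglongrightarrow> ennreal (L f)"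
    using tendsto_ennrealI[OF lim] step by simp
  ultimately show "(\<integral>\<^sup>+x. ennreal (f x) \<partial>\<kappa>) = ennreal (L f)"
    using LIMSEQ_unique by metis
qed

lemma has_bochner_integral:
  assumes \<kappa>: "sets \<kappa> = sets M"
    "\<And>A. A \<in> R \<Longrightarrow> 0 \<le> L (indicator A)"
    "\<And>A. A \<in> R \<Longrightarrow> emeasure \<kappa> A = ennreal (L (indicator A))"
    and f: "f \<in> Y"
  shows "has_bochner_integral \<kappa> f (L f)"
proof -
  have [measurable]: "f \<in> borel_measurable M" using f by (rule Y_measurable)
  let ?p = "\<lambda>x. max 0 (f x)" and ?n = "\<lambda>x. max 0 (- f x)"
  have Y: "?p \<in> Y" "?n \<in> Y" by (rule Y_ideal[OF f]; auto)+
  have nn: "has_bochner_integral \<kappa> g (L g)" if "g \<in> Y" "\<And>x. 0 \<le> g x" for g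
    using nn_integral_eq[OF \<kappa> that] that Y_measurable[OF that(1)] \<kappa>(1)
    by (intro has_bochner_integral_nn_integral) (simp_all cong: measurable_cong_sets)
  have "has_bochner_integral \<kappa> (\<lambda>x. ?p x + (-1) * ?n x) (L ?p + (-1) * L ?n)"
    using nn[OF Y(1)] nn[OF Y(2)] by (intro has_bochner_integral_add has_bochner_integral_mult_right) auto
  moreover have "(\<lambda>x. ?p x + (-1) * ?n x) = f" by (auto simp: max_def)
  moreover have "L (\<lambda>x. ?p x + (-1) * ?n x) = L ?p + (-1) * L ?n"
    by (simp only: L_add[OF Y(1) Y_scale[OF Y(2)]] L_scale[OF Y(2)])
  ultimately show ?thesis by simp
qed

lemma integral_representation:
  assumes f: "f \<in> Y"
  shows "integrable (var_measure M R (\<lambda>A. L (indicator A))) f"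
    and "A \<in> sets M \<Longrightarrow> scal_int M R (\<lambda>A. L (indicator A)) A f = L (\<lambda>x. indicator A x * f x)"
proof -
  obtain P where P: "P \<in> sets M"
    "\<And>A. A \<in> R \<Longrightarrow> 0 \<le> L (indicator (A \<inter> P))" "\<And>A. A \<in> R \<Longrightarrow> L (indicator (A - P)) \<le> 0"
    "\<And>A. A \<in> R \<Longrightarrow> posvar R (\<lambda>A. L (indicator A)) A = ennreal (L (indicator (A \<inter> P)))"
    "\<And>A. A \<in> R \<Longrightarrow> negvar R (\<lambda>A. L (indicator A)) A = ennreal (- L (indicator (A - P)))"
    using \<nu>.Hahn_decomposition by metis
  define Lp where "Lp f = 1 * L (\<lambda>x. indicator P x * f x)" for f
  define Ln where "Ln f = (-1) * L (\<lambda>x. indicator (space M - P) x * f x)" for f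
  have Q: "space M - P \<in> sets M" using P(1) by auto
  interpret Lp: order_cont_functional M R Y Lp unfolding Lp_def[abs_def] using P(1) by (rule restrict)
  interpret Ln: order_cont_functional M R Y Ln unfolding Ln_def[abs_def] using Q by (rule restrict)
  interpret Lt: order_cont_functional M R Y "\<lambda>f. Lp f + Ln f" by (rule Lp.plus[OF Ln.order_cont_functional_axioms])
  have Lp_ind: "Lp (indicator A) = L (indicator (A \<inter> P))" for A
  proof -
    have "(\<lambda>x. indicator P x * indicator A x :: real) = indicator (A \<inter> P)"
      by (auto simp: indicator_def fun_eq_iff)
    then show ?thesis by (simp add: Lp_def)
  qed
  have Ln_ind: "Ln (indicator A) = - L (indicator (A - P))" if "A \<in> R" for A
  proof -
    have "(\<lambda>x. indicator (space M - P) x * indicator A x :: real) = indicator (A - P)"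
      using sets.sets_into_space[OF R_sets[OF that]] by (auto simp: indicator_def fun_eq_iff)
    then show ?thesis by (simp add: Ln_def)
  qed
  have p: "has_bochner_integral \<nu>.pos_measure g (Lp g)" if "g \<in> Y" for g
    using that P(2,4) R_sets by (intro Lp.has_bochner_integral) (auto simp: Lp_ind \<nu>.emeasure_pos)
  have n: "has_bochner_integral \<nu>.neg_measure g (Ln g)" if "g \<in> Y" for g
    using that P(3,5) R_sets by (intro Ln.has_bochner_integral) (auto simp: Ln_ind \<nu>.emeasure_neg)
  \<comment> \<open>On R the total variation is the sum of both variations, which
    \<open>Lp + Ln\<close> represents. So f is integrable for the total variation as well.\<close>
  have "has_bochner_integral \<nu>.tot_measure f (Lp f + Ln f)"
  proof (rule Lt.has_bochner_integral[OF _ _ _ f])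
    fix A assume A: "A \<in> R"
    then have nn: "0 \<le> Lp (indicator A)" "0 \<le> Ln (indicator A)"
      using P(2,3) by (simp_all add: Lp_ind Ln_ind)
    then show "0 \<le> Lp (indicator A) + Ln (indicator A)" by simp
    show "emeasure \<nu>.tot_measure A = ennreal (Lp (indicator A) + Ln (indicator A))"
      unfolding ennreal_plus[OF nn] using A P(4,5) R_sets by (simp add: \<nu>.emeasure_tot Lp_ind Ln_ind)
  qed simp
  then show "integrable (var_measure M R (\<lambda>A. L (indicator A))) f" by (simp add: has_bochner_integral_iff)
  assume A: "A \<in> sets M"
  let ?g = "\<lambda>x. indicator A x * f x"
  have g: "?g \<in> Y" using f A by (rule Y_restrict)
  have "scal_int M R (\<lambda>A. L (indicator A)) A f = Lp ?g - Ln ?g"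
    using p[OF g] n[OF g]
    by (simp add: scal_int_def has_bochner_integral_iff \<nu>.pos_measure_def \<nu>.neg_measure_def)
  \<comment> \<open>\<open>Ln\<close> carries the sign -1, so \<open>Lp - Ln\<close> adds the
    restrictions of L to P and to its complement and recovers L.\<close>
  also have "\<dots> = L (\<lambda>x. indicator P x * ?g x + indicator (space M - P) x * ?g x)"
    by (subst L_add) (auto simp: Lp_def Ln_def intro!: Y_restrict g P(1) Q)
  also have "\<dots> = L ?g"
    by (intro L_cong Y_add Y_restrict g P(1) Q) (auto simp: indicator_def)
  finally show "scal_int M R (\<lambda>A. L (indicator A)) A f = L ?g" .
qed

end

section \<open>Ideal function spaces\<close>

lemma aew_null_sets: "aew M (null_sets M) P \<longleftrightarrow> (AE x in M. P x)"
  by (simp add: aew_def eventually_ae_filter)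

lemma ifs_measurable: "ifs M Nl Y \<Longrightarrow> f \<in> Y \<Longrightarrow> f \<in> borel_measurable M"
  and ifs_zero: "ifs M Nl Y \<Longrightarrow> (\<lambda>x. 0) \<in> Y"
  and ifs_add: "ifs M Nl Y \<Longrightarrow> f \<in> Y \<Longrightarrow> g \<in> Y \<Longrightarrow> (\<lambda>x. f x + g x) \<in> Y"
  and ifs_scale: "ifs M Nl Y \<Longrightarrow> f \<in> Y \<Longrightarrow> (\<lambda>x. c * f x) \<in> Y"
  by (auto simp: ifs_def)

lemma ifs_ideal:
  "ifs M (null_sets M) Y \<Longrightarrow> f \<in> Y \<Longrightarrow> g \<in> borel_measurable M \<Longrightarrow> (AE x in M. \<bar>g x\<bar> \<le> \<bar>f x\<bar>) \<Longrightarrow> g \<in> Y"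
  unfolding ifs_def aew_null_sets by blast

lemma ifs_ideal_space:
  "ifs M (null_sets M) Y \<Longrightarrow> f \<in> Y \<Longrightarrow> g \<in> borel_measurable M \<Longrightarrow>
    (\<And>x. x \<in> space M \<Longrightarrow> \<bar>g x\<bar> \<le> \<bar>f x\<bar>) \<Longrightarrow> g \<in> Y"
  by (rule ifs_ideal) auto

lemma lin_op_cong: "lin_op M Nl Y T \<Longrightarrow> f \<in> Y \<Longrightarrow> g \<in> Y \<Longrightarrow> aew M Nl (\<lambda>x. f x = g x) \<Longrightarrow> T f = T g"
  and lin_op_add: "lin_op M Nl Y T \<Longrightarrow> f \<in> Y \<Longrightarrow> g \<in> Y \<Longrightarrow> T (\<lambda>x. f x + g x) = T f + T g"
  and lin_op_scale: "lin_op M Nl Y T \<Longrightarrow> f \<in> Y \<Longrightarrow> T (\<lambda>x. c * f x) = c *\<^sub>R T f"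
  by (simp_all add: lin_op_def)

text \<open>Bounding |a + b| by twice the maximum treats exponents below and above 1 alike, whereas
  convexity would cover only q \<ge> 1.\<close>

lemma powr_add_le:
  fixes a b q :: real
  assumes "0 < q"
  shows "\<bar>a + b\<bar> powr q \<le> 2 powr q * (\<bar>a\<bar> powr q + \<bar>b\<bar> powr q)"
proof -
  have "\<bar>a + b\<bar> powr q \<le> (2 * max \<bar>a\<bar> \<bar>b\<bar>) powr q"
    using assms by (intro powr_mono2) auto
  also have "\<dots> = 2 powr q * (max \<bar>a\<bar> \<bar>b\<bar>) powr q" by (simp add: powr_mult)
  also have "\<dots> \<le> 2 powr q * (\<bar>a\<bar> powr q + \<bar>b\<bar> powr q)"
    by (intro mult_left_mono) (auto simp: max_def)
  finally show ?thesis .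
qed

lemma ifs_ifs_pow:
  assumes Y: "ifs M (null_sets M) Y" and q: "0 < q"
  shows "ifs M (null_sets M) (ifs_pow M Y q)"
  unfolding ifs_def aew_null_sets
proof (intro conjI ballI allI impI)
  show "ifs_pow M Y q \<subseteq> borel_measurable M" by (auto simp: ifs_pow_def)
  show "(\<lambda>x. 0) \<in> ifs_pow M Y q" using ifs_zero[OF Y] by (simp add: ifs_pow_def)
  fix f assume "f \<in> ifs_pow M Y q"
  then have f: "f \<in> borel_measurable M" "(\<lambda>x. \<bar>f x\<bar> powr q) \<in> Y" by (auto simp: ifs_pow_def)
  note [measurable] = f(1)
  show "(\<lambda>x. c * f x) \<in> ifs_pow M Y q" for c
    using ifs_scale[OF Y f(2), of "\<bar>c\<bar> powr q"] by (simp add: ifs_pow_def abs_mult powr_mult)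
  fix g
  show "(\<lambda>x. f x + g x) \<in> ifs_pow M Y q" if "g \<in> ifs_pow M Y q"
  proof -
    have g: "g \<in> borel_measurable M" "(\<lambda>x. \<bar>g x\<bar> powr q) \<in> Y" using that by (auto simp: ifs_pow_def)
    note [measurable] = g(1)
    have "(\<lambda>x. 2 powr q * (\<bar>f x\<bar> powr q + \<bar>g x\<bar> powr q)) \<in> Y"
      by (intro ifs_scale[OF Y] ifs_add[OF Y] f g)
    then have "(\<lambda>x. \<bar>f x + g x\<bar> powr q) \<in> Y"
      by (rule ifs_ideal_space[OF Y]) (use powr_add_le[OF q] in \<open>auto simp: abs_mult\<close>)
    then show ?thesis by (simp add: ifs_pow_def)
  qed
  show "g \<in> ifs_pow M Y q" if g[measurable]: "g \<in> borel_measurable M" and le: "AE x in M. \<bar>g x\<bar> \<le> \<bar>f x\<bar>"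
  proof -
    have "AE x in M. \<bar>\<bar>g x\<bar> powr q\<bar> \<le> \<bar>\<bar>f x\<bar> powr q\<bar>"
      using le by eventually_elim (use q in \<open>auto intro: powr_mono2\<close>)
    then have "(\<lambda>x. \<bar>g x\<bar> powr q) \<in> Y" by (intro ifs_ideal[OF Y f(2)]) auto
    then show ?thesis by (simp add: ifs_pow_def)
  qed
qed

lemma ifs_ifs_sum:
  assumes Y: "ifs M (null_sets M) Y" and W: "ifs M (null_sets M) W"
  shows "ifs M (null_sets M) (ifs_sum M (null_sets M) Y W)"
  unfolding ifs_def aew_null_sets
proof (intro conjI ballI allI impI)
  let ?S = "ifs_sum M (null_sets M) Y W"
  have I: "f \<in> ?S" if "f \<in> borel_measurable M" "f1 \<in> Y" "f2 \<in> W" "AE x in M. f x = f1 x + f2 x" for f f1 f2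
    using that by (auto simp: ifs_sum_def aew_null_sets)
  show "?S \<subseteq> borel_measurable M" by (auto simp: ifs_sum_def)
  show "(\<lambda>x. 0) \<in> ?S" using ifs_zero[OF Y] ifs_zero[OF W] by (rule I[rotated]) auto
  fix f assume "f \<in> ?S"
  then obtain f1 f2 where f[measurable]: "f \<in> borel_measurable M" and f12: "f1 \<in> Y" "f2 \<in> W"
    and f_eq: "AE x in M. f x = f1 x + f2 x" by (auto simp: ifs_sum_def aew_null_sets)
  note [measurable] = ifs_measurable[OF Y f12(1)] ifs_measurable[OF W f12(2)]
  show "(\<lambda>x. c * f x) \<in> ?S" for c
    using ifs_scale[OF Y f12(1), of c] ifs_scale[OF W f12(2), of c] f_eq
    by (intro I[of _ "\<lambda>x. c * f1 x" "\<lambda>x. c * f2 x"]) (auto simp: algebra_simps)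
  fix g
  show "(\<lambda>x. f x + g x) \<in> ?S" if gS: "g \<in> ?S"
  proof -
    obtain g1 g2 where g[measurable]: "g \<in> borel_measurable M" and g12: "g1 \<in> Y" "g2 \<in> W"
      and g_eq: "AE x in M. g x = g1 x + g2 x" using gS by (auto simp: ifs_sum_def aew_null_sets)
    have "AE x in M. f x + g x = (f1 x + g1 x) + (f2 x + g2 x)"
      using f_eq g_eq by eventually_elim simp
    then show ?thesis by (intro I[OF _ ifs_add[OF Y f12(1) g12(1)] ifs_add[OF W f12(2) g12(2)]]) auto
  qed
  show "g \<in> ?S" if g[measurable]: "g \<in> borel_measurable M" and le: "AE x in M. \<bar>g x\<bar> \<le> \<bar>f x\<bar>"
  proof -
    \<comment> \<open>g is truncated to the interval [-|f1|, |f1|]. Since |g| \<le> |f1| + |f2|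
      a.e., what remains is bounded by |f2|, which splits g between the two ideals.\<close>
    define g1 where "g1 x = max (- \<bar>f1 x\<bar>) (min \<bar>f1 x\<bar> (g x))" for x
    have [measurable]: "g1 \<in> borel_measurable M" unfolding g1_def[abs_def] by measurable
    have "g1 \<in> Y" by (rule ifs_ideal_space[OF Y f12(1)]) (auto simp: g1_def)
    moreover have "AE x in M. \<bar>g x - g1 x\<bar> \<le> \<bar>f2 x\<bar>"
      using f_eq le by eventually_elim (auto simp: g1_def)
    then have "(\<lambda>x. g x - g1 x) \<in> W" by (intro ifs_ideal[OF W f12(2)]) auto
    ultimately show ?thesis by (intro I[of g g1 "\<lambda>x. g x - g1 x"]) auto
  qed
qed


section \<open>Integration with respect to a vector measure\<close>

lemma totvar_cong: "(\<And>B. B \<in> R \<Longrightarrow> \<nu> B = \<nu>' B) \<Longrightarrow> totvar R \<nu> = totvar R \<nu>'"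
  unfolding totvar_def fun_eq_iff by (intro allI SUP_cong refl arg_cong[where f = ennreal] sum.cong) auto

lemma posvar_cong: "(\<And>B. B \<in> R \<Longrightarrow> \<nu> B = \<nu>' B) \<Longrightarrow> posvar R \<nu> = posvar R \<nu>'"
  and negvar_cong: "(\<And>B. B \<in> R \<Longrightarrow> \<nu> B = \<nu>' B) \<Longrightarrow> negvar R \<nu> = negvar R \<nu>'"
  unfolding posvar_def negvar_def fun_eq_iff by (intro allI SUP_cong refl; simp)+

lemma scal_int_cong:
  assumes "sets M' = sets M" "\<And>B. B \<in> R \<Longrightarrow> \<nu> B = \<nu>' B"
  shows "scal_int M' R \<nu> = scal_int M R \<nu>'"
proof -
  have "posvar R \<nu> = posvar R \<nu>'" "negvar R \<nu> = negvar R \<nu>'"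
    by (rule posvar_cong negvar_cong, erule assms)+
  then show ?thesis
    using sets_eq_imp_space_eq[OF assms(1)] assms(1) by (intro ext) (simp add: scal_int_def)
qed

lemma var_measure_cong:
  assumes "sets M' = sets M" "\<And>B. B \<in> R \<Longrightarrow> \<nu> B = \<nu>' B"
  shows "var_measure M' R \<nu> = var_measure M R \<nu>'"
  using totvar_cong[of R \<nu> \<nu>'] assms sets_eq_imp_space_eq[OF assms(1)]
  by (simp add: var_measure_def)

lemma L1_vm_cong:
  fixes m m' :: "'a set \<Rightarrow> 'e::real_normed_vector"
  assumes "sets M' = sets M" "\<And>B. B \<in> R \<Longrightarrow> m B = m' B"
  shows "L1_vm M' R m = L1_vm M R m'"
proof -
  have "scal_int M' R (\<lambda>B. \<phi> (m B)) = scal_int M R (\<lambda>B. \<phi> (m' B))"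
    "var_measure M' R (\<lambda>B. \<phi> (m B)) = var_measure M R (\<lambda>B. \<phi> (m' B))" for \<phi> :: "'e \<Rightarrow> real"
    using assms by (auto intro!: scal_int_cong var_measure_cong)
  then show ?thesis
    using assms(1) by (simp add: L1_vm_def measurable_cong_sets[OF assms(1) refl])
qed

lemma I_vm_cong:
  fixes m m' :: "'a set \<Rightarrow> 'e::real_normed_vector"
  assumes "sets M' = sets M" "\<And>B. B \<in> R \<Longrightarrow> m B = m' B"
  shows "I_vm M' R m = I_vm M R m'"
proof -
  have "scal_int M' R (\<lambda>B. \<phi> (m B)) = scal_int M R (\<lambda>B. \<phi> (m' B))" for \<phi> :: "'e \<Rightarrow> real"
    using assms by (auto intro!: scal_int_cong)
  then show ?thesis using sets_eq_imp_space_eq[OF assms(1)] by (simp add: I_vm_def fun_eq_iff)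
qed

lemma delta_ring_measure_cong:
  assumes "delta_ring_measure M' R \<nu>" and sets: "sets M' = sets M" and eq: "\<And>B. B \<in> R \<Longrightarrow> \<nu> B = \<nu>' B"
  shows "delta_ring_measure M R \<nu>'"
proof -
  interpret \<nu>: delta_ring_measure M' R \<nu> by fact
  show ?thesis
  proof
    show "A \<in> sets M" if "A \<in> R" for A using \<nu>.R_sets[OF that] sets by simp
    show "B \<in> R" if "A \<in> R" "B \<in> sets M" "B \<subseteq> A" for A B
      using \<nu>.R_subset[OF that(1) _ that(3)] that(2) sets by simp
    show "\<exists>\<Omega>::nat \<Rightarrow> 'a set. range \<Omega> \<subseteq> R \<and> (\<Union>n. \<Omega> n) = space M"
      using \<nu>.R_cover by (simp only: sets_eq_imp_space_eq[OF sets])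
    fix A :: "nat \<Rightarrow> 'a set"
    assume A: "range A \<subseteq> R" "disjoint_family A" "(\<Union>n. A n) \<in> R"
    then have "A n \<in> R" for n by auto
    then have "(\<lambda>n. \<nu> (A n)) = (\<lambda>n. \<nu>' (A n))" by (simp only: eq)
    then show "(\<lambda>n. \<nu>' (A n)) sums \<nu>' (\<Union>n. A n)"
      using \<nu>.countably_add[OF A] by (simp only: eq[OF A(3)])
  qed (fact \<nu>.R_Un)
qed

lemma vm_nulls_cong:
  fixes m m' :: "'a set \<Rightarrow> 'e::real_normed_vector"
  assumes "sets M' = sets M" "\<And>B. B \<in> R \<Longrightarrow> m B = m' B"
  shows "vm_nulls M' R m = vm_nulls M R m'"
proof -
  have "totvar R (\<lambda>B. \<phi> (m B)) = totvar R (\<lambda>B. \<phi> (m' B))" for \<phi> :: "'e \<Rightarrow> real"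
    using assms(2) by (auto intro!: totvar_cong)
  then show ?thesis using assms(1) by (simp add: vm_nulls_def)
qed

text \<open>Additivity is asked of the scalar measures \<phi> \<circ> m because
  \<open>L1_vm\<close>, \<open>I_vm\<close> and \<open>vm_nulls\<close> see m only through
  them.\<close>

locale weak_vector_measure =
  fixes M :: "'a measure" and R :: "'a set set" and m :: "'a set \<Rightarrow> 'e::real_normed_vector"
  assumes scalar: "bounded_linear (\<phi>::'e \<Rightarrow> real) \<Longrightarrow> delta_ring_measure M R (\<lambda>A. \<phi> (m A))"
begin

abbreviation "pos \<phi> \<equiv> measure_of (space M) (sets M) (posvar R (\<lambda>B. \<phi> (m B)))"
abbreviation "neg \<phi> \<equiv> measure_of (space M) (sets M) (negvar R (\<lambda>B. \<phi> (m B)))"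

lemma L1_measurable: "f \<in> L1_vm M R m \<Longrightarrow> f \<in> borel_measurable M"
  by (simp add: L1_vm_def)

lemma L1_ex_integral:
  assumes "f \<in> L1_vm M R m" "A \<in> sets M"
  obtains v where "\<And>\<phi>::'e \<Rightarrow> real. bounded_linear \<phi> \<Longrightarrow> \<phi> v = scal_int M R (\<lambda>B. \<phi> (m B)) A f"
proof -
  have "\<exists>v. \<forall>\<phi>::'e \<Rightarrow> real. bounded_linear \<phi> \<longrightarrow> \<phi> v = scal_int M R (\<lambda>B. \<phi> (m B)) A f"
    using assms by (simp add: L1_vm_def)
  then obtain v where "\<forall>\<phi>::'e \<Rightarrow> real. bounded_linear \<phi> \<longrightarrow> \<phi> v = scal_int M R (\<lambda>B. \<phi> (m B)) A f" ..
  then show ?thesis by (intro that) simp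
qed

lemma L1_integrable:
  assumes "f \<in> L1_vm M R m" "bounded_linear (\<phi>::'e \<Rightarrow> real)"
  shows "integrable (pos \<phi>) f" "integrable (neg \<phi>) f"
proof -
  interpret \<nu>: delta_ring_measure M R "\<lambda>A. \<phi> (m A)" by (rule scalar) fact
  have "integrable \<nu>.tot_measure f" using assms by (simp add: L1_vm_def)
  then show "integrable (pos \<phi>) f" "integrable (neg \<phi>) f"
    using \<nu>.integrable_tot_imp by (simp_all add: \<nu>.pos_measure_def \<nu>.neg_measure_def)
qed

lemma AE_variation:
  assumes "aew M (vm_nulls M R m) P" "bounded_linear (\<phi>::'e \<Rightarrow> real)"
  shows "AE x in pos \<phi>. P x" "AE x in neg \<phi>. P x" "AE x in var_measure M R (\<lambda>B. \<phi> (m B)). P x"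
proof -
  interpret \<nu>: delta_ring_measure M R "\<lambda>A. \<phi> (m A)" by (rule scalar) fact
  obtain N where N: "N \<in> sets M" "totvar R (\<lambda>B. \<phi> (m B)) N = 0" "{x \<in> space M. \<not> P x} \<subseteq> N"
    using assms by (auto simp: aew_def vm_nulls_def)
  then have "posvar R (\<lambda>B. \<phi> (m B)) N = 0" "negvar R (\<lambda>B. \<phi> (m B)) N = 0"
    by (simp_all add: \<nu>.totvar_eq)
  then have "N \<in> null_sets \<nu>.pos_measure" "N \<in> null_sets \<nu>.neg_measure" "N \<in> null_sets \<nu>.tot_measure"
    using N(1) by (auto simp: null_sets_def \<nu>.emeasure_pos \<nu>.emeasure_neg \<nu>.emeasure_tot)
  then have "AE x in \<nu>.pos_measure. P x" "AE x in \<nu>.neg_measure. P x" "AE x in \<nu>.tot_measure. P x"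
    using N(3) by (auto intro!: AE_I'[where N = N])
  then show "AE x in pos \<phi>. P x" "AE x in neg \<phi>. P x" "AE x in var_measure M R (\<lambda>B. \<phi> (m B)). P x"
    unfolding \<nu>.pos_measure_def \<nu>.neg_measure_def .
qed

lemma integrable_indicator_mult:
  fixes f :: "'a \<Rightarrow> real"
  shows "A \<in> sets N \<Longrightarrow> integrable N f \<Longrightarrow> integrable N (\<lambda>x. indicator A x * f x)"
  using integrable_mult_indicator[of A N f] by simp

lemma scal_int_add:
  assumes "f \<in> L1_vm M R m" "g \<in> L1_vm M R m" "bounded_linear (\<phi>::'e \<Rightarrow> real)" "A \<in> sets M"
  shows "scal_int M R (\<lambda>B. \<phi> (m B)) A (\<lambda>x. f x + g x) =
    scal_int M R (\<lambda>B. \<phi> (m B)) A f + scal_int M R (\<lambda>B. \<phi> (m B)) A g"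
  using L1_integrable[OF assms(1,3)] L1_integrable[OF assms(2,3)] assms(4)
  by (simp add: scal_int_def distrib_left integrable_indicator_mult)

lemma scal_int_scale: "scal_int M R \<nu> A (\<lambda>x. c * f x) = c * scal_int M R \<nu> A f"
  by (simp add: scal_int_def mult.left_commute[of _ c] right_diff_distrib)

lemma scal_int_cong_AE:
  assumes "f \<in> borel_measurable M" "g \<in> borel_measurable M" "aew M (vm_nulls M R m) (\<lambda>x. f x = g x)"
    "bounded_linear (\<phi>::'e \<Rightarrow> real)" "A \<in> sets M"
  shows "scal_int M R (\<lambda>B. \<phi> (m B)) A f = scal_int M R (\<lambda>B. \<phi> (m B)) A g"
proof -
  note [measurable] = assms(1,2,5)
  have "(\<integral>x. indicator A x * f x \<partial>N) = (\<integral>x. indicator A x * g x \<partial>N)"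
    if "sets N = sets M" "AE x in N. f x = g x" for N
    using that(2) that(1)[measurable_cong] by (intro integral_cong_AE) (auto elim: eventually_mono)
  then show ?thesis using AE_variation[OF assms(3,4)] by (simp add: scal_int_def)
qed

lemma L1_add:
  assumes "f \<in> L1_vm M R m" "g \<in> L1_vm M R m" shows "(\<lambda>x. f x + g x) \<in> L1_vm M R m"
  unfolding L1_vm_def
proof (intro CollectI conjI ballI allI impI)
  show "(\<lambda>x. f x + g x) \<in> borel_measurable M" using assms L1_measurable by auto
  show "integrable (var_measure M R (\<lambda>B. \<phi> (m B))) (\<lambda>x. f x + g x)" if "bounded_linear \<phi>" for \<phi>
    using assms that by (auto simp: L1_vm_def)
  fix A assume A: "A \<in> sets M"
  obtain v where v: "\<And>\<phi>::'e \<Rightarrow> real. bounded_linear \<phi> \<Longrightarrow> \<phi> v = scal_int M R (\<lambda>B. \<phi> (m B)) A f"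
    using L1_ex_integral[OF assms(1) A] by blast
  obtain w where w: "\<And>\<phi>::'e \<Rightarrow> real. bounded_linear \<phi> \<Longrightarrow> \<phi> w = scal_int M R (\<lambda>B. \<phi> (m B)) A g"
    using L1_ex_integral[OF assms(2) A] by blast
  show "\<exists>v. \<forall>\<phi>::'e \<Rightarrow> real. bounded_linear \<phi> \<longrightarrow>
      \<phi> v = scal_int M R (\<lambda>B. \<phi> (m B)) A (\<lambda>x. f x + g x)"
    using assms A v w by (intro exI[of _ "v + w"]) (simp add: scal_int_add linear_simps)
qed

lemma L1_cong:
  assumes f: "f \<in> L1_vm M R m" and g: "g \<in> borel_measurable M" "aew M (vm_nulls M R m) (\<lambda>x. f x = g x)"
  shows "g \<in> L1_vm M R m"
  unfolding L1_vm_def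
proof (intro CollectI conjI ballI allI impI)
  show "g \<in> borel_measurable M" by fact
  note eq = scal_int_cong_AE[OF L1_measurable[OF f] g]
  show "integrable (var_measure M R (\<lambda>B. \<phi> (m B))) g" if \<phi>: "bounded_linear \<phi>" for \<phi>
  proof -
    interpret \<nu>: delta_ring_measure M R "\<lambda>A. \<phi> (m A)" by (rule scalar) fact
    have "integrable \<nu>.tot_measure f" using f \<phi> by (auto simp: L1_vm_def)
    moreover have "f \<in> borel_measurable \<nu>.tot_measure" "g \<in> borel_measurable \<nu>.tot_measure"
      using L1_measurable[OF f] g(1) by (simp_all cong: measurable_cong_sets)
    ultimately show ?thesis
      using AE_variation(3)[OF g(2) \<phi>] by (metis integrable_cong_AE)
  qed
  fix A assume A: "A \<in> sets M"
  obtain v where "\<And>\<phi>::'e \<Rightarrow> real. bounded_linear \<phi> \<Longrightarrow> \<phi> v = scal_int M R (\<lambda>B. \<phi> (m B)) A f"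
    using L1_ex_integral[OF f A] by blast
  then show "\<exists>v. \<forall>\<phi>::'e \<Rightarrow> real. bounded_linear \<phi> \<longrightarrow> \<phi> v = scal_int M R (\<lambda>B. \<phi> (m B)) A g"
    using eq[OF _ A] by auto
qed

text \<open>Since \<open>L1_vm\<close> asks for an integral over every measurable set, the integral of f is a difference
of two integrals of |f|; this avoids proving that \<open>L1_vm\<close> is an ideal.\<close>

lemma L1_abs:
  assumes f: "f \<in> borel_measurable M" and abs: "(\<lambda>x. \<bar>f x\<bar>) \<in> L1_vm M R m"
  shows "f \<in> L1_vm M R m"
  unfolding L1_vm_def
proof (intro CollectI conjI ballI allI impI)
  show "f \<in> borel_measurable M" by fact
  show "integrable (var_measure M R (\<lambda>B. \<phi> (m B))) f" if \<phi>: "bounded_linear \<phi>" for \<phi>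
  proof -
    interpret \<nu>: delta_ring_measure M R "\<lambda>A. \<phi> (m A)" by (rule scalar) fact
    have "integrable \<nu>.tot_measure (\<lambda>x. \<bar>f x\<bar>)" using abs \<phi> by (auto simp: L1_vm_def)
    then show ?thesis by (rule integrable_abs_cancel) (use f in \<open>simp cong: measurable_cong_sets\<close>)
  qed
  fix A assume A: "A \<in> sets M"
  define P where "P = {x \<in> space M. 0 < f x}"
  have P: "P \<in> sets M" unfolding P_def using f by measurable
  have AP: "A \<inter> P \<in> sets M" "A - P \<in> sets M" using A P by auto
  obtain v where v: "\<And>\<phi>::'e \<Rightarrow> real. bounded_linear \<phi> \<Longrightarrow>
      \<phi> v = scal_int M R (\<lambda>B. \<phi> (m B)) (A \<inter> P) (\<lambda>x. \<bar>f x\<bar>)"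
    using L1_ex_integral[OF abs AP(1)] by blast
  obtain w where w: "\<And>\<phi>::'e \<Rightarrow> real. bounded_linear \<phi> \<Longrightarrow>
      \<phi> w = scal_int M R (\<lambda>B. \<phi> (m B)) (A - P) (\<lambda>x. \<bar>f x\<bar>)"
    using L1_ex_integral[OF abs AP(2)] by blast
  have "\<phi> (v - w) = scal_int M R (\<lambda>B. \<phi> (m B)) A f" if \<phi>: "bounded_linear \<phi>" for \<phi>
  proof -
    have eq: "(\<integral>x. indicator A x * f x \<partial>N) =
        (\<integral>x. indicator (A \<inter> P) x * \<bar>f x\<bar> \<partial>N) - (\<integral>x. indicator (A - P) x * \<bar>f x\<bar> \<partial>N)"
      if N: "sets N = sets M" and int: "integrable N (\<lambda>x. \<bar>f x\<bar>)" for N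
    proof -
      have "(\<integral>x. indicator A x * f x \<partial>N) =
          (\<integral>x. indicator (A \<inter> P) x * \<bar>f x\<bar> - indicator (A - P) x * \<bar>f x\<bar> \<partial>N)"
        using sets_eq_imp_space_eq[OF N]
        by (intro Bochner_Integration.integral_cong) (auto simp: P_def indicator_def)
      also have "\<dots> = (\<integral>x. indicator (A \<inter> P) x * \<bar>f x\<bar> \<partial>N) - (\<integral>x. indicator (A - P) x * \<bar>f x\<bar> \<partial>N)"
        using A P int by (intro Bochner_Integration.integral_diff integrable_indicator_mult) (auto simp: N)
      finally show ?thesis .
    qed
    have "sets (pos \<phi>) = sets M" "sets (neg \<phi>) = sets M" by simp_all
    then show ?thesis
      using v[OF \<phi>] w[OF \<phi>] \<phi> eq L1_integrable[OF abs \<phi>] by (simp add: linear_simps scal_int_def)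
  qed
  then show "\<exists>v. \<forall>\<phi>::'e \<Rightarrow> real. bounded_linear \<phi> \<longrightarrow> \<phi> v = scal_int M R (\<lambda>B. \<phi> (m B)) A f"
    by blast
qed

lemma I_vm_eqI:
  assumes v: "\<And>\<phi>::'e \<Rightarrow> real. bounded_linear \<phi> \<Longrightarrow> \<phi> v = scal_int M R (\<lambda>B. \<phi> (m B)) (space M) f"
  shows "I_vm M R m f = v"
  unfolding I_vm_def
proof (rule some_equality)
  show "\<forall>\<phi>::'e \<Rightarrow> real. bounded_linear \<phi> \<longrightarrow> \<phi> v = scal_int M R (\<lambda>B. \<phi> (m B)) (space M) f"
    using v by simp
  fix w assume w: "\<forall>\<phi>::'e \<Rightarrow> real. bounded_linear \<phi> \<longrightarrow> \<phi> w = scal_int M R (\<lambda>B. \<phi> (m B)) (space M) f"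
  show "w = v"
  proof (rule bounded_linear_functionals_separate)
    fix \<phi> :: "'e \<Rightarrow> real" assume \<phi>: "bounded_linear \<phi>"
    then show "\<phi> w = \<phi> v" using w by (simp add: v[OF \<phi>])
  qed
qed

lemma I_vm_eq:
  assumes "f \<in> L1_vm M R m" "bounded_linear (\<phi>::'e \<Rightarrow> real)"
  shows "\<phi> (I_vm M R m f) = scal_int M R (\<lambda>B. \<phi> (m B)) (space M) f"
proof -
  have "\<exists>v. \<forall>\<phi>::'e \<Rightarrow> real. bounded_linear \<phi> \<longrightarrow> \<phi> v = scal_int M R (\<lambda>B. \<phi> (m B)) (space M) f"
    using assms(1) by (auto simp: L1_vm_def)
  from someI_ex[OF this] show ?thesis using assms(2) by (simp add: I_vm_def)
qed

lemma lin_op_I_vm: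
  assumes V: "V \<subseteq> L1_vm M R m"
  shows "lin_op M (vm_nulls M R m) V (I_vm M R m)"
  unfolding lin_op_def
proof (intro conjI ballI allI impI)
  fix f assume "f \<in> V"
  then have f: "f \<in> L1_vm M R m" using V by blast
  show "I_vm M R m (\<lambda>x. c * f x) = c *\<^sub>R I_vm M R m f" for c
    using f by (intro I_vm_eqI) (simp add: I_vm_eq scal_int_scale linear_simps)
  fix g assume "g \<in> V"
  then have g: "g \<in> L1_vm M R m" using V by blast
  show "I_vm M R m (\<lambda>x. f x + g x) = I_vm M R m f + I_vm M R m g"
    using f g by (intro I_vm_eqI) (simp add: I_vm_eq scal_int_add linear_simps)
  assume "aew M (vm_nulls M R m) (\<lambda>x. f x = g x)"
  then show "I_vm M R m f = I_vm M R m g"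
    using f g by (intro I_vm_eqI) (simp add: I_vm_eq scal_int_cong_AE[OF L1_measurable L1_measurable])
qed

lemma order_w_cont_I_vm:
  assumes V: "V \<subseteq> L1_vm M R m"
  shows "order_w_cont M (vm_nulls M R m) V (I_vm M R m)"
  unfolding order_w_cont_def weak_conv_def
proof (intro allI impI)
  fix fs :: "nat \<Rightarrow> 'a \<Rightarrow> real" and f and \<phi> :: "'e \<Rightarrow> real"
  assume "\<forall>n. fs n \<in> V" "f \<in> V"
    and inc: "aew M (vm_nulls M R m) (\<lambda>x. (\<forall>n. 0 \<le> fs n x \<and> fs n x \<le> fs (Suc n) x) \<and> (\<lambda>n. fs n x) \<longlonglongrightarrow> f x)"
    and \<phi>: "bounded_linear \<phi>"
  then have f: "fs n \<in> L1_vm M R m" "f \<in> L1_vm M R m" for n using V by auto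
  have conv: "(\<lambda>n. \<integral>x. indicator (space M) x * fs n x \<partial>N) \<longlonglongrightarrow> (\<integral>x. indicator (space M) x * f x \<partial>N)"
    if N: "sets N = sets M" "integrable N f"
      and ae: "AE x in N. (\<forall>n. 0 \<le> fs n x \<and> fs n x \<le> fs (Suc n) x) \<and> (\<lambda>n. fs n x) \<longlonglongrightarrow> f x" for N
  \<comment> \<open>The increasing nonnegative sequence is dominated by its own limit, which is
    integrable for both variations.\<close>
  proof (rule integral_dominated_convergence[where w = "\<lambda>x. \<bar>f x\<bar>"])
    note [measurable] = L1_measurable[OF f(1)] L1_measurable[OF f(2)] and [measurable_cong] = N(1)
    show "(\<lambda>x. indicator (space M) x * f x) \<in> borel_measurable N"
      "(\<lambda>x. indicator (space M) x * fs n x) \<in> borel_measurable N" for n by measurable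
    show "integrable N (\<lambda>x. \<bar>f x\<bar>)" using N(2) by simp
    show "AE x in N. (\<lambda>n. indicator (space M) x * fs n x) \<longlonglongrightarrow> indicator (space M) x * f x"
      using ae by eventually_elim (auto intro: tendsto_mult_left)
    show "AE x in N. norm (indicator (space M) x * fs n x) \<le> \<bar>f x\<bar>" for n
      using ae
    proof eventually_elim
      case (elim x)
      then have "fs n x \<le> f x" by (intro incseq_le) (auto simp: incseq_Suc_iff)
      moreover have "0 \<le> fs n x" using elim by blast
      ultimately show ?case by (auto simp: indicator_def)
    qed
  qed
  show "(\<lambda>n. \<phi> (I_vm M R m (fs n))) \<longlonglongrightarrow> \<phi> (I_vm M R m f)"
    unfolding I_vm_eq[OF f(1) \<phi>] I_vm_eq[OF f(2) \<phi>] scal_int_def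
    using L1_integrable[OF f(2) \<phi>] AE_variation[OF inc \<phi>] by (intro tendsto_diff conv) auto
qed

text \<open>If |f1| powr (1/p) lies in W, it lies in the p-th power space, so its p-th power |f1| is
  integrable. Hence the whole sum space lies in \<open>L1_vm\<close>, where \<open>I_vm\<close> is
  already linear and order-w continuous and so serves as its own extension.\<close>

lemma pth_power_factorable_I_vm:
  assumes p: "0 < p"
  defines "W \<equiv> Lp_vm M R m p \<inter> L1_vm M R m"
  shows "pth_power_factorable M (vm_nulls M R m) W (I_vm M R m) p"
proof -
  let ?V = "ifs_sum M (vm_nulls M R m) (ifs_pow M W (1 / p)) W"
  have "f \<in> L1_vm M R m" if fV: "f \<in> ?V" for f
  proof -
    obtain f1 f2 where f: "f \<in> borel_measurable M" "f1 \<in> ifs_pow M W (1 / p)" "f2 \<in> W"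
      "aew M (vm_nulls M R m) (\<lambda>x. f x = f1 x + f2 x)"
      using fV by (auto simp: ifs_sum_def)
    have "(\<lambda>x. \<bar>\<bar>f1 x\<bar> powr (1 / p)\<bar> powr p) \<in> L1_vm M R m"
      using f(2) by (simp add: ifs_pow_def W_def Lp_vm_def)
    moreover have "\<bar>\<bar>f1 x\<bar> powr (1 / p)\<bar> powr p = \<bar>f1 x\<bar>" for x
      using p by (simp add: powr_powr)
    ultimately have abs: "(\<lambda>x. \<bar>f1 x\<bar>) \<in> L1_vm M R m" by (simp only:)
    have "f1 \<in> borel_measurable M" using f(2) by (simp add: ifs_pow_def)
    then have "f1 \<in> L1_vm M R m" using abs by (rule L1_abs)
    then have "(\<lambda>x. f1 x + f2 x) \<in> L1_vm M R m" using f(3) by (intro L1_add) (auto simp: W_def)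
    then show ?thesis by (rule L1_cong) (use f in \<open>simp_all add: eq_commute\<close>)
  qed
  then have "?V \<subseteq> L1_vm M R m" by blast
  then show ?thesis
    unfolding pth_power_factorable_def using lin_op_I_vm order_w_cont_I_vm by blast
qed

end

section \<open>Optimal factorization\<close>

text \<open>To be instantiated over \<xi> with the sum of Z and its power of exponent 1/p as Y, and
  with the extension of S as T, while R remains the delta-ring of X.\<close>

locale order_w_cont_operator =
  fixes M :: "'a measure" and R :: "'a set set" and Y :: "('a \<Rightarrow> real) set"
    and T :: "('a \<Rightarrow> real) \<Rightarrow> 'e::real_normed_vector"
  assumes R_sets: "A \<in> R \<Longrightarrow> A \<in> sets M"
    and R_subset: "A \<in> R \<Longrightarrow> B \<in> sets M \<Longrightarrow> B \<subseteq> A \<Longrightarrow> B \<in> R"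
    and R_Un: "A \<in> R \<Longrightarrow> B \<in> R \<Longrightarrow> A \<union> B \<in> R"
    and R_cover: "\<exists>\<Omega>::nat \<Rightarrow> 'a set. range \<Omega> \<subseteq> R \<and> (\<Union>n. \<Omega> n) = space M"
    and R_indicator: "A \<in> R \<Longrightarrow> indicator A \<in> Y"
    and ifs: "ifs M (null_sets M) Y"
    and lin_op: "lin_op M (null_sets M) Y T"
    and order_w_cont: "order_w_cont M (null_sets M) Y T"
begin

lemma functional:
  assumes \<phi>: "bounded_linear (\<phi>::'e \<Rightarrow> real)"
  shows "order_cont_functional M R Y (\<lambda>f. \<phi> (T f))"
proof
  show "\<exists>\<Omega>::nat \<Rightarrow> 'a set. range \<Omega> \<subseteq> R \<and> (\<Union>n. \<Omega> n) = space M" by (rule R_cover)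
  show "(\<lambda>x. 0) \<in> Y" using ifs by (rule ifs_zero)
  fix f assume f: "f \<in> Y"
  show "f \<in> borel_measurable M" using ifs f by (rule ifs_measurable)
  show "(\<lambda>x. c * f x) \<in> Y" for c using ifs f by (rule ifs_scale)
  show "\<phi> (T (\<lambda>x. c * f x)) = c * \<phi> (T f)" for c
    using \<phi> by (simp add: lin_op_scale[OF lin_op f] linear_simps)
  show "g \<in> Y" if "g \<in> borel_measurable M" "\<And>x. x \<in> space M \<Longrightarrow> \<bar>g x\<bar> \<le> \<bar>f x\<bar>" for g
    using ifs f that by (rule ifs_ideal_space)
  fix g assume g: "g \<in> Y"
  show "(\<lambda>x. f x + g x) \<in> Y" using ifs f g by (rule ifs_add)
  show "\<phi> (T (\<lambda>x. f x + g x)) = \<phi> (T f) + \<phi> (T g)"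
    using \<phi> by (simp add: lin_op_add[OF lin_op f g] linear_simps)
  show "\<phi> (T f) = \<phi> (T g)" if "\<And>x. x \<in> space M \<Longrightarrow> f x = g x"
  proof -
    have "AE x in M. f x = g x" using that by (rule AE_I2)
    then have "T f = T g" by (intro lin_op_cong[OF lin_op f g]) (simp only: aew_null_sets)
    then show ?thesis by simp
  qed
next
  fix fs :: "nat \<Rightarrow> 'a \<Rightarrow> real" and f
  assume "\<And>n. fs n \<in> Y" "f \<in> Y"
    "\<And>n x. x \<in> space M \<Longrightarrow> 0 \<le> fs n x \<and> fs n x \<le> fs (Suc n) x"
    "\<And>x. x \<in> space M \<Longrightarrow> (\<lambda>n. fs n x) \<longlonglongrightarrow> f x"
  then show "(\<lambda>n. \<phi> (T (fs n))) \<longlonglongrightarrow> \<phi> (T f)"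
    using order_w_cont \<phi> by (simp add: order_w_cont_def aew_null_sets weak_conv_def)
qed (fact R_sets R_subset R_Un R_indicator | assumption)+

sublocale weak_vector_measure M R "m_T T"
proof (rule weak_vector_measure.intro)
  show "delta_ring_measure M R (\<lambda>A. \<phi> (m_T T A))" if "bounded_linear \<phi>" for \<phi> :: "'e \<Rightarrow> real"
    unfolding m_T_def by (rule order_cont_functional.delta_ring_measure[OF functional[OF that]])
qed

lemma scal_int_eq:
  assumes "f \<in> Y" "A \<in> sets M" "bounded_linear (\<phi>::'e \<Rightarrow> real)"
  shows "scal_int M R (\<lambda>B. \<phi> (m_T T B)) A f = \<phi> (T (\<lambda>x. indicator A x * f x))"
  unfolding m_T_def by (rule order_cont_functional.integral_representation(2)[OF functional]) fact+

lemma subset_L1_vm: "Y \<subseteq> L1_vm M R (m_T T)"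
proof
  fix f assume f: "f \<in> Y"
  have "integrable (var_measure M R (\<lambda>B. \<phi> (m_T T B))) f" if "bounded_linear (\<phi>::'e \<Rightarrow> real)" for \<phi>
    unfolding m_T_def by (rule order_cont_functional.integral_representation(1)[OF functional]) fact+
  then show "f \<in> L1_vm M R (m_T T)"
    unfolding L1_vm_def using ifs_measurable[OF ifs f] scal_int_eq[OF f] by auto
qed

lemma I_vm_eq_operator:
  assumes f: "f \<in> Y" shows "I_vm M R (m_T T) f = T f"
proof (rule I_vm_eqI)
  fix \<phi> :: "'e \<Rightarrow> real" assume \<phi>: "bounded_linear \<phi>"
  interpret order_cont_functional M R Y "\<lambda>f. \<phi> (T f)" using \<phi> by (rule functional)
  show "\<phi> (T f) = scal_int M R (\<lambda>B. \<phi> (m_T T B)) (space M) f"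
    unfolding scal_int_eq[OF f sets.top \<phi>] by (intro L_cong f Y_restrict) auto
qed

text \<open>T cannot distinguish the indicator of a null set from 0, so m vanishes on every member
  of R inside N. Over \<xi> this yields that \<xi>-null sets are null for the vector measure, the
  absolute continuity behind the map [i] on Z.\<close>

lemma null_sets_subset_vm_nulls: "null_sets M \<subseteq> vm_nulls M R (m_T T)"
proof
  fix N assume N: "N \<in> null_sets M"
  have "m_T T B = 0" if B: "B \<in> R" "B \<subseteq> N" for B
  proof -
    have "B \<in> null_sets M" using N B R_sets by (blast intro: null_sets_subset)
    then have "AE x in M. indicator B x = (0::real)"
      by (intro AE_I'[where N = B]) (auto simp: indicator_def)
    then have "T (indicator B) = T (\<lambda>x. 0)"
      by (intro lin_op_cong[OF lin_op R_indicator[OF B(1)] ifs_zero[OF ifs]]) (simp only: aew_null_sets)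
    also have "\<dots> = 0" using lin_op_scale[OF lin_op ifs_zero[OF ifs], of 0] by simp
    finally show ?thesis by (simp add: m_T_def)
  qed
  then have "totvar R (\<lambda>B. \<phi> (m_T T B)) N = 0" if "bounded_linear \<phi>" for \<phi> :: "'e \<Rightarrow> real"
    unfolding totvar_def using that
    by (intro antisym SUP_least) (auto simp: linear_simps subset_iff intro!: sum.neutral)
  then show "N \<in> vm_nulls M R (m_T T)" using N by (auto simp: vm_nulls_def)
qed

end

text \<open>Everything is proved over \<xi> for the extension \<open>S'\<close> of S and then
  carried to M and T. The choice \<xi> = M, Z = X and S = T is admissible, so one lemma serves both
  existence and optimality.\<close>

lemma factorization:
  fixes T S :: "('a \<Rightarrow> real) \<Rightarrow> 'e::real_normed_vector"
  assumes X: "ifs M (null_sets M) X" and X_sigma: "sigma_property M X" and p: "0 < p"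
    and \<xi>: "sets \<xi> = sets M" and Z: "ifs \<xi> (null_sets \<xi>) Z" and XZ: "X \<subseteq> Z"
    and TS: "\<And>f. f \<in> X \<Longrightarrow> T f = S f"
    and S: "pth_power_factorable \<xi> (null_sets \<xi>) Z S p"
  defines "R \<equiv> Sigma_X M X"
  shows "weak_vector_measure M R (m_T T)"
    and "null_sets \<xi> \<subseteq> vm_nulls M R (m_T T)"
    and "Z \<subseteq> Lp_vm M R (m_T T) p \<inter> L1_vm M R (m_T T)"
    and "\<And>f. f \<in> Z \<Longrightarrow> S f = I_vm M R (m_T T) f"
proof -
  let ?Zp = "ifs_pow \<xi> Z (1 / p)"
  let ?Y = "ifs_sum \<xi> (null_sets \<xi>) ?Zp Z"
  have Zp: "ifs \<xi> (null_sets \<xi>) ?Zp" using Z p by (intro ifs_ifs_pow) auto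
  have Y: "ifs \<xi> (null_sets \<xi>) ?Y" using Zp Z by (rule ifs_ifs_sum)
  have ZY: "f \<in> ?Y" if "f \<in> Z" for f
    unfolding ifs_sum_def aew_null_sets
    using that ifs_measurable[OF Z that] ifs_zero[OF Zp] by (force intro!: bexI[of _ "\<lambda>x. 0"] bexI[of _ f])
  have ZpY: "f \<in> ?Y" if "f \<in> ?Zp" for f
    unfolding ifs_sum_def aew_null_sets
    using that ifs_measurable[OF Zp that] ifs_zero[OF Z] by (force intro!: bexI[of _ "\<lambda>x. 0"] bexI[of _ f])
  obtain S' where S': "lin_op \<xi> (null_sets \<xi>) ?Y S'" "order_w_cont \<xi> (null_sets \<xi>) ?Y S'"
    "\<And>f. f \<in> Z \<Longrightarrow> S' f = S f"
    using S by (auto simp: pth_power_factorable_def)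
  interpret S': order_w_cont_operator \<xi> R ?Y S'
  proof
    show R_sets: "A \<in> sets \<xi>" if "A \<in> R" for A using that \<xi> by (auto simp: R_def Sigma_X_def)
    show "B \<in> R" if "A \<in> R" "B \<in> sets \<xi>" "B \<subseteq> A" for A B
      using that \<xi> unfolding R_def Sigma_X_def
      by (auto intro!: ifs_ideal_space[OF X, of "indicator A"] simp: indicator_def)
    show "A \<union> B \<in> R" if "A \<in> R" "B \<in> R" for A B
    proof -
      have "(\<lambda>x. indicator A x + indicator B x :: real) \<in> X"
        using that by (intro ifs_add[OF X]) (auto simp: R_def Sigma_X_def)
      then have "(indicator (A \<union> B) :: 'a \<Rightarrow> real) \<in> X"
        by (rule ifs_ideal_space[OF X]) (use that in \<open>auto simp: R_def Sigma_X_def indicator_def\<close>)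
      then show ?thesis using that by (auto simp: R_def Sigma_X_def)
    qed
    show "\<exists>\<Omega>::nat \<Rightarrow> 'a set. range \<Omega> \<subseteq> R \<and> (\<Union>n. \<Omega> n) = space \<xi>"
      using X_sigma sets_eq_imp_space_eq[OF \<xi>] unfolding sigma_property_def R_def Sigma_X_def by (auto simp: image_subset_iff)
    show "indicator A \<in> ?Y" if "A \<in> R" for A
      using that XZ by (intro ZY) (auto simp: R_def Sigma_X_def)
  qed (fact Y S')+
  \<comment> \<open>Indicators of sets in R lie in X, where \<open>S'\<close>, S and T coincide. Off
    R the set functions may differ, so all transfers to M go through congruence on R.\<close>
  have m: "m_T S' B = m_T T B" if "B \<in> R" for B
    using that XZ TS[of "indicator B"] S'(3)[of "indicator B"] by (auto simp: m_T_def R_def Sigma_X_def)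
  have L1: "L1_vm \<xi> R (m_T S') = L1_vm M R (m_T T)" and I: "I_vm \<xi> R (m_T S') = I_vm M R (m_T T)"
    using \<xi> m by (auto intro!: L1_vm_cong I_vm_cong)
  show "weak_vector_measure M R (m_T T)"
  proof (rule weak_vector_measure.intro)
    show "delta_ring_measure M R (\<lambda>A. \<phi> (m_T T A))" if "bounded_linear \<phi>" for \<phi> :: "'e \<Rightarrow> real"
      by (rule delta_ring_measure_cong[OF S'.scalar[OF that] \<xi>]) (simp only: m)
  qed
  have "vm_nulls \<xi> R (m_T S') = vm_nulls M R (m_T T)"
    using \<xi> m by (rule vm_nulls_cong)
  with S'.null_sets_subset_vm_nulls show "null_sets \<xi> \<subseteq> vm_nulls M R (m_T T)" by (rule subst[rotated])
  show "S f = I_vm M R (m_T T) f" if "f \<in> Z" for f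
    using S'.I_vm_eq_operator[OF ZY[OF that]] S'(3)[OF that] by (simp add: I)
  show "Z \<subseteq> Lp_vm M R (m_T T) p \<inter> L1_vm M R (m_T T)"
  proof
    fix f assume f: "f \<in> Z"
    have fM [measurable]: "f \<in> borel_measurable \<xi>" using Z f by (rule ifs_measurable)
    have "(\<lambda>x. \<bar>f x\<bar>) \<in> Z" by (rule ifs_ideal_space[OF Z f]) auto
    \<comment> \<open>Raising |f| powr p to the power 1/p gives back |f|, which lies in Z. This is
      where factorability enters: \<open>S'\<close>, unlike S, acts on |f| powr p and thereby makes
      it integrable.\<close>
    then have "(\<lambda>x. \<bar>f x\<bar> powr p) \<in> ?Zp" using p by (simp add: ifs_pow_def powr_powr)
    then have "(\<lambda>x. \<bar>f x\<bar> powr p) \<in> L1_vm M R (m_T T)" using ZpY S'.subset_L1_vm L1 by blast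
    moreover have "f \<in> L1_vm M R (m_T T)" using ZY[OF f] S'.subset_L1_vm L1 by blast
    moreover have "f \<in> borel_measurable M" using fM measurable_cong_sets[OF \<xi> refl] by blast
    ultimately show "f \<in> Lp_vm M R (m_T T) p \<inter> L1_vm M R (m_T T)" by (simp add: Lp_vm_def)
  qed
qed

theorem theorem4p2:
  fixes M :: "'a measure"
    and X :: "('a \<Rightarrow> real) set"
    and T :: "('a \<Rightarrow> real) \<Rightarrow> 'e::banach"
    and p :: real
  assumes X_ifs: "ifs M (null_sets M) X"
    and X_sigma: "sigma_property M X"
    and p_pos: "0 < p"
    and T_lin: "lin_op M (null_sets M) X T"
    and T_fact: "pth_power_factorable M (null_sets M) X T p"
  shows
    "(null_sets M \<subseteq> vm_nulls M (Sigma_X M X) (m_T T) \<and>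
      X \<subseteq> Lp_vm M (Sigma_X M X) (m_T T) p \<inter> L1_vm M (Sigma_X M X) (m_T T)) \<and>
     (\<forall>f\<in>X. T f = I_vm M (Sigma_X M X) (m_T T) f) \<and>
     pth_power_factorable M (vm_nulls M (Sigma_X M X) (m_T T))
        (Lp_vm M (Sigma_X M X) (m_T T) p \<inter> L1_vm M (Sigma_X M X) (m_T T))
        (I_vm M (Sigma_X M X) (m_T T)) p \<and>
     (\<forall>(\<xi>::'a measure) (Z :: ('a \<Rightarrow> real) set) (S :: ('a \<Rightarrow> real) \<Rightarrow> 'e).
       sets \<xi> = sets M \<longrightarrow> absolutely_continuous M \<xi> \<longrightarrow>
       ifs \<xi> (null_sets \<xi>) Z \<longrightarrow> X \<subseteq> Z \<longrightarrow>
       lin_op \<xi> (null_sets \<xi>) Z S \<longrightarrow> (\<forall>f\<in>X. T f = S f) \<longrightarrow>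
       pth_power_factorable \<xi> (null_sets \<xi>) Z S p \<longrightarrow>
       null_sets \<xi> \<subseteq> vm_nulls M (Sigma_X M X) (m_T T) \<and>
       Z \<subseteq> Lp_vm M (Sigma_X M X) (m_T T) p \<inter> L1_vm M (Sigma_X M X) (m_T T) \<and>
       (\<forall>f\<in>Z. S f = I_vm M (Sigma_X M X) (m_T T) f))"
proof -
  note fact_T = factorization[OF X_ifs X_sigma p_pos refl X_ifs subset_refl refl T_fact]
  have "pth_power_factorable M (vm_nulls M (Sigma_X M X) (m_T T))
      (Lp_vm M (Sigma_X M X) (m_T T) p \<inter> L1_vm M (Sigma_X M X) (m_T T))
      (I_vm M (Sigma_X M X) (m_T T)) p"
    by (rule weak_vector_measure.pth_power_factorable_I_vm[OF fact_T(1) p_pos])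
  moreover have "null_sets \<xi> \<subseteq> vm_nulls M (Sigma_X M X) (m_T T) \<and>
       Z \<subseteq> Lp_vm M (Sigma_X M X) (m_T T) p \<inter> L1_vm M (Sigma_X M X) (m_T T) \<and>
       (\<forall>f\<in>Z. S f = I_vm M (Sigma_X M X) (m_T T) f)"
    if "sets \<xi> = sets M" "ifs \<xi> (null_sets \<xi>) Z" "X \<subseteq> Z" "\<forall>f\<in>X. T f = S f"
      "pth_power_factorable \<xi> (null_sets \<xi>) Z S p"
    for \<xi> :: "'a measure" and Z and S :: "('a \<Rightarrow> real) \<Rightarrow> 'e"
    using factorization(2-4)[OF X_ifs X_sigma p_pos that(1-3) bspec[OF that(4)] that(5)] by blast
  ultimately show ?thesis using fact_T(2-4) by blast
qed

end
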